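(* Let $X$ be a Banach space and let $1\le p<\infty$. The following are equivalent: (1) $X$ is finite-dimensional; (2) $X$ satisfies $(A_p')$: every $L_p(X)$-bounded sequence of functions that converges scalarly a.e. also converges weakly a.e.; (3) $X$ satisfies $(A_p)$: every $L_p(X)$-bounded sequence of functions that converges scalarly a.e. has a subsequence that converges weakly a.e.; (4) $X$ satisfies $(B_p)$: every $L_p(X)$-bounded sequence of functions that converges scalarly in measure has a subsequence that converges weakly a.e.; (5) $X$ satisfies $(C_p)$: every $L_p(X)$-bounded sequence of functions that converges scalarly in $L_p$ has a subsequence that converges weakly a.e.
   Context: $(\Omega,\Sigma,\mu)$ is the Lebesgue measure space on $[0,1]$. Banach spaces are real. $L_0(X)$ is the space of (classes of a.e. equal) strongly measurable functions $f:\Omega\to X$; $L_p(X)$ are the Bochner–Lebesgue spaces, $L_p=L_p(\mathbb R)$. For $f_n,f\in L_0(X)$: - $\{f_n\}$ converges scalarly a.e. (resp. scalarly in measure, resp. scalarly in $L_p$) to $f$ if for each $x^*\in X^*$, $x^*f_n\to x^*f$ almost everywhere (resp. in measure, resp. in $L_p$); - $\{f_n\}$ converges weakly a.e. to $f$ if there is a set $A$ of full measure (independent of $x^*$) such that $x^*f_n(\omega)\to x^*f(\omega)$ for all $\omega\in A$ and all $x^*\in X^*$. Each "converges" means converges to some $f\in L_0(X)$. A sequence $\{f_n\}$ is $L_p(X)$-bounded if $\sup_n\|f_n\|_{L_p(X)}<\infty$. *)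

theory Defs
  imports "HOL-Analysis.Analysis"
begin

abbreviation Omega :: "real measure" where
  "Omega \<equiv> lebesgue_on {0..1}"

text \<open>
  Membership in \<open>L\<^sub>0(X)\<close>. The library's \<open>borel_measurable\<close> is not strong measurability unless
  the range space is second countable, so the definition by simple functions is spelled out.
  Functions serve as representatives of their classes of a.e. equal functions; their values
  outside \<open>[0,1]\<close> are irrelevant.
\<close>
definition strongly_measurable :: "(real \<Rightarrow> 'a::banach) \<Rightarrow> bool" where
  "strongly_measurable f \<longleftrightarrow>
     (\<exists>s. (\<forall>k. simple_function Omega (s k)) \<and>
          (AE \<omega> in Omega. (\<lambda>k::nat. s k \<omega>) \<longlonglongrightarrow> f \<omega>))"

definition in_Lp :: "real \<Rightarrow> (real \<Rightarrow> 'a::banach) \<Rightarrow> bool" where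
  "in_Lp p f \<longleftrightarrow> strongly_measurable f \<and> integrable Omega (\<lambda>\<omega>. norm (f \<omega>) powr p)"

definition Lp_norm :: "real \<Rightarrow> (real \<Rightarrow> 'a::banach) \<Rightarrow> real" where
  "Lp_norm p f = (\<integral>\<omega>. norm (f \<omega>) powr p \<partial>Omega) powr (1 / p)"

definition Lp_bounded :: "real \<Rightarrow> (nat \<Rightarrow> real \<Rightarrow> 'a::banach) \<Rightarrow> bool" where
  "Lp_bounded p f \<longleftrightarrow> (\<forall>n. in_Lp p (f n)) \<and> bdd_above (range (\<lambda>n. Lp_norm p (f n)))"

definition conv_ae :: "(nat \<Rightarrow> real \<Rightarrow> real) \<Rightarrow> (real \<Rightarrow> real) \<Rightarrow> bool" where
  "conv_ae g h \<longleftrightarrow> (AE \<omega> in Omega. (\<lambda>n. g n \<omega>) \<longlonglongrightarrow> h \<omega>)"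

definition conv_in_measure :: "(nat \<Rightarrow> real \<Rightarrow> real) \<Rightarrow> (real \<Rightarrow> real) \<Rightarrow> bool" where
  "conv_in_measure g h \<longleftrightarrow>
     (\<forall>\<epsilon>>0. (\<lambda>n. measure Omega {\<omega> \<in> space Omega. \<bar>g n \<omega> - h \<omega>\<bar> > \<epsilon>}) \<longlonglongrightarrow> 0)"

definition conv_in_Lp :: "real \<Rightarrow> (nat \<Rightarrow> real \<Rightarrow> real) \<Rightarrow> (real \<Rightarrow> real) \<Rightarrow> bool" where
  "conv_in_Lp p g h \<longleftrightarrow>
     (\<forall>n. in_Lp p (g n)) \<and> in_Lp p h \<and> (\<lambda>n. Lp_norm p (\<lambda>\<omega>. g n \<omega> - h \<omega>)) \<longlonglongrightarrow> 0"

text \<open>The dual \<open>X\<^sup>*\<close> is the type of bounded linear functions into the reals.\<close>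

definition scalarly ::
  "((nat \<Rightarrow> real \<Rightarrow> real) \<Rightarrow> (real \<Rightarrow> real) \<Rightarrow> bool) \<Rightarrow> (nat \<Rightarrow> real \<Rightarrow> 'a::banach) \<Rightarrow> bool" where
  "scalarly conv f \<longleftrightarrow>
     (\<exists>g. strongly_measurable g \<and>
          (\<forall>x' :: 'a \<Rightarrow>\<^sub>L real. conv (\<lambda>n \<omega>. blinfun_apply x' (f n \<omega>)) (\<lambda>\<omega>. blinfun_apply x' (g \<omega>))))"

definition converges_weakly_ae :: "(nat \<Rightarrow> real \<Rightarrow> 'a::banach) \<Rightarrow> bool" where
  "converges_weakly_ae f \<longleftrightarrow>
     (\<exists>g. strongly_measurable g \<and>
          (AE \<omega> in Omega. \<forall>x' :: 'a \<Rightarrow>\<^sub>L real.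
             (\<lambda>n. blinfun_apply x' (f n \<omega>)) \<longlonglongrightarrow> blinfun_apply x' (g \<omega>)))"

definition has_weakly_ae_convergent_subseq :: "(nat \<Rightarrow> real \<Rightarrow> 'a::banach) \<Rightarrow> bool" where
  "has_weakly_ae_convergent_subseq f \<longleftrightarrow>
     (\<exists>r :: nat \<Rightarrow> nat. strict_mono r \<and> converges_weakly_ae (\<lambda>k. f (r k)))"

definition property_A' :: "'a::banach itself \<Rightarrow> real \<Rightarrow> bool" where
  "property_A' _ p \<longleftrightarrow>
     (\<forall>f :: nat \<Rightarrow> real \<Rightarrow> 'a. Lp_bounded p f \<and> scalarly conv_ae f
        \<longrightarrow> converges_weakly_ae f)"

definition property_A :: "'a::banach itself \<Rightarrow> real \<Rightarrow> bool" where
  "property_A _ p \<longleftrightarrow>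
     (\<forall>f :: nat \<Rightarrow> real \<Rightarrow> 'a. Lp_bounded p f \<and> scalarly conv_ae f
        \<longrightarrow> has_weakly_ae_convergent_subseq f)"

definition property_B :: "'a::banach itself \<Rightarrow> real \<Rightarrow> bool" where
  "property_B _ p \<longleftrightarrow>
     (\<forall>f :: nat \<Rightarrow> real \<Rightarrow> 'a. Lp_bounded p f \<and> scalarly conv_in_measure f
        \<longrightarrow> has_weakly_ae_convergent_subseq f)"

definition property_C :: "'a::banach itself \<Rightarrow> real \<Rightarrow> bool" where
  "property_C _ p \<longleftrightarrow>
     (\<forall>f :: nat \<Rightarrow> real \<Rightarrow> 'a. Lp_bounded p f \<and> scalarly (conv_in_Lp p) f
        \<longrightarrow> has_weakly_ae_convergent_subseq f)"

definition finite_dimensional :: "'a::banach itself \<Rightarrow> bool" where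
  "finite_dimensional _ \<longleftrightarrow> (\<exists>B :: 'a set. finite B \<and> span B = UNIV)"

end

theory Submission
  imports Defs
begin

text \<open>
  In finite dimension the dual is spanned by finitely many functionals, so their exceptional null
  sets (or the extractions of subsequences) can be combined.

  In infinite dimension one sequence refutes all the properties. The key is that for every
  \<open>\<epsilon> > 0\<close> there are unit vectors \<open>x\<^sub>1, \<dots>, x\<^sub>T\<close> such that every functional in the dual unit ball is
  at most \<open>\<epsilon>\<close> in absolute value on average over them. This replaces the use of Dvoretzky's theorem:
  on an \<open>n\<close>-dimensional subspace, a probability measure on the dual ball always admits a unit vector
  with mean square at most \<open>2 / n\<close> (compare traces in an orthonormal basis), and playing such
  vectors against the multiplicative weights strategy on a finite net of the dual ball yields the
  minimax conclusion. Placing these vectors, with independent, heavy-tailed but \<open>L\<^sub>p\<close>-bounded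
  norms, on cells given by mixed radix digits produces functions that tend to \<open>0\<close> scalarly, a.e.
  and in \<open>L\<^sub>p\<close>, while every subsequence is a.e. unbounded in norm. By the uniform boundedness principle no
  subsequence converges weakly a.e.
\<close>

section \<open>Functionals on normed spaces\<close>

definition sublinear :: "('a::real_vector \<Rightarrow> real) \<Rightarrow> bool" where
  "sublinear q \<longleftrightarrow> (\<forall>x y. q (x + y) \<le> q x + q y) \<and> (\<forall>t\<ge>0. \<forall>x. q (t *\<^sub>R x) = t * q x)"

lemma sublinear_add: "sublinear q \<Longrightarrow> q (x + y) \<le> q x + q y"
  and sublinear_scale: "sublinear q \<Longrightarrow> 0 \<le> t \<Longrightarrow> q (t *\<^sub>R x) = t * q x"
  by (auto simp: sublinear_def)

lemma sublinear_zero: "sublinear q \<Longrightarrow> q 0 = 0"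
  using sublinear_scale[of q 0 0] by simp

lemma sublinear_minus: "sublinear q \<Longrightarrow> - q (- x) \<le> q x"
  using sublinear_add[of q x "- x"] sublinear_zero[of q] by simp

text \<open>The functional is lowered along \<open>z\<close> to the infimum over
  \<open>t \<ge> 0\<close> of \<open>q (x + t *\<^sub>R z) - t * q z\<close>; \<open>t = 0\<close>
  gives domination by \<open>q\<close>, and \<open>t = 1\<close> at \<open>- z\<close> gives the
  last bound. This serves twice: a minimal \<open>q\<close> must coincide with the lowered one,
  hence is odd, and lowering the norm prescribes a value at a given vector.\<close>

lemma sublinear_directional:
  fixes q :: "'a::real_vector \<Rightarrow> real"
  assumes q: "sublinear q"
  obtains q' where "sublinear q'" "\<And>x. q' x \<le> q x" "q' (- z) \<le> - q z"
proof -
  define g where "g x t = q (x + t *\<^sub>R z) - t * q z" for x t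
  define q' where "q' x = (INF t\<in>{0..}. g x t)" for x
  \<comment> \<open>Subadditivity on \<open>t *\<^sub>R z = (x + t *\<^sub>R z) + (- x)\<close>
    gives a bound independent of \<open>t\<close>, so the infimum is a genuine one.\<close>
  have lb: "- q (- x) \<le> g x t" if "0 \<le> t" for x t
    using sublinear_add[OF q, of "x + t *\<^sub>R z" "- x"] sublinear_scale[OF q that, of z]
    by (simp add: g_def)
  have bdd: "bdd_below (g x ` {0..})" for x
    by (rule bdd_belowI2[of _ "- q (- x)"]) (simp add: lb)
  have le: "q' x \<le> g x t" if "0 \<le> t" for x t
    unfolding q'_def by (rule cINF_lower[OF bdd]) (use that in simp)
  have ge: "b \<le> q' x" if "\<And>t. 0 \<le> t \<Longrightarrow> b \<le> g x t" for b x
    unfolding q'_def by (rule cINF_greatest) (use that in auto)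
  have add: "q' (x + y) \<le> q' x + q' y" for x y
  proof -
    have *: "q' (x + y) \<le> g x s + g y t" if "0 \<le> s" "0 \<le> t" for s t
    proof -
      have "q' (x + y) \<le> g (x + y) (s + t)"
        using that by (intro le) auto
      also have "\<dots> \<le> g x s + g y t"
        using sublinear_add[OF q, of "x + s *\<^sub>R z" "y + t *\<^sub>R z"]
        by (simp add: g_def algebra_simps)
      finally show ?thesis .
    qed
    \<comment> \<open>The infimum is taken over \<open>t\<close> with \<open>s\<close> fixed, and
      over \<open>s\<close> afterwards.\<close>
    have "q' (x + y) - g x s \<le> q' y" if "0 \<le> s" for s
      using *[OF that] by (intro ge) (simp add: algebra_simps)
    hence "q' (x + y) - q' y \<le> q' x"
      by (intro ge) (simp add: algebra_simps)
    thus ?thesis by simp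
  qed
  have scale_le: "q' (c *\<^sub>R x) \<le> c * q' x" if "0 < c" for c x
  proof -
    have "q' (c *\<^sub>R x) / c \<le> g x s" if "0 \<le> s" for s
    proof -
      have "q' (c *\<^sub>R x) \<le> g (c *\<^sub>R x) (c * s)"
        using \<open>0 < c\<close> that by (intro le) auto
      also have "\<dots> = c * g x s"
        using sublinear_scale[OF q, of c "x + s *\<^sub>R z"] \<open>0 < c\<close>
        by (simp add: g_def algebra_simps)
      finally show ?thesis using \<open>0 < c\<close> by (simp add: field_simps)
    qed
    hence "q' (c *\<^sub>R x) / c \<le> q' x" by (rule ge)
    thus ?thesis using \<open>0 < c\<close> by (simp add: field_simps)
  qed
  have zero: "q' 0 = 0"
  proof (rule antisym)
    show "q' 0 \<le> 0" using le[of 0 0] by (simp add: g_def sublinear_zero[OF q])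
    show "0 \<le> q' 0" using lb[of _ 0] by (intro ge) (simp add: sublinear_zero[OF q])
  qed
  have scale: "q' (c *\<^sub>R x) = c * q' x" if "0 \<le> c" for c x
  proof (cases "c = 0")
    case False
    hence c: "0 < c" using that by simp
    have "q' x \<le> inverse c * q' (c *\<^sub>R x)"
      using scale_le[of "inverse c" "c *\<^sub>R x"] c by simp
    hence "c * q' x \<le> q' (c *\<^sub>R x)" using c by (simp add: field_simps)
    thus ?thesis using scale_le[OF c, of x] by simp
  qed (simp add: zero)
  show thesis
  proof
    show "sublinear q'" using add scale by (simp add: sublinear_def)
    show "q' x \<le> q x" for x using le[of 0 x] by (simp add: g_def)
    show "q' (- z) \<le> - q z" using le[of 1 "- z"] by (simp add: g_def sublinear_zero[OF q])
  qed
qed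

text \<open>Minimal sublinear functionals are linear, so Zorn's lemma replaces the one-dimensional
  extension step of the usual proof of the Hahn--Banach theorem.\<close>

lemma sublinear_dominates_linear:
  fixes q :: "'a::real_vector \<Rightarrow> real"
  assumes q: "sublinear q"
  obtains m where "linear m" "\<And>x. m x \<le> q x"
proof -
  define A where "A = {m. sublinear m \<and> (\<forall>x. m x \<le> q x)}"
  \<comment> \<open>The order is reversed, so that the maximal element of Zorn's lemma is a minimal
    functional and the bound of a chain is its pointwise infimum.\<close>
  define P where "P a b \<longleftrightarrow> (\<forall>x. b x \<le> a x)" for a b :: "'a \<Rightarrow> real"
  have "\<exists>m\<in>A. \<forall>a\<in>A. P m a \<longrightarrow> a = m"
  proof (rule predicate_Zorn)
    show "partial_order_on A (relation_of P A)"
      by (rule partial_order_on_relation_ofI) (auto simp: P_def fun_eq_iff intro: order_trans antisym)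
  next
    fix C assume C: "C \<in> Chains (relation_of P A)"
    have CA: "C \<subseteq> A" using C by (auto simp: Chains_def relation_of_def)
    show "\<exists>u\<in>A. \<forall>a\<in>C. P a u"
    proof (cases "C = {}")
      case True
      thus ?thesis using q by (auto simp: A_def)
    next
      case False
      define u where "u x = (INF m\<in>C. m x)" for x
      have "- q (- x) \<le> m x" if "m \<in> C" for m x
      proof -
        have m: "sublinear m" "m (- x) \<le> q (- x)" using that CA by (auto simp: A_def)
        show ?thesis using sublinear_minus[OF m(1), of x] m(2) by linarith
      qed
      hence bdd: "bdd_below ((\<lambda>m. m x) ` C)" for x
        by (rule bdd_belowI2)
      have le: "u x \<le> m x" if "m \<in> C" for m x
        unfolding u_def by (rule cINF_lower[OF bdd that])
      have ge: "b \<le> u x" if "\<And>m. m \<in> C \<Longrightarrow> b \<le> m x" for b x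
        unfolding u_def by (rule cINF_greatest[OF False that])
      have "u (x + y) \<le> u x + u y" for x y
      proof -
        \<comment> \<open>Two members of a chain are comparable; the smaller one, \<open>l\<close>,
          is evaluated at both points.\<close>
        have *: "u (x + y) \<le> m x + n y" if "m \<in> C" "n \<in> C" for m n
        proof -
          have "P m n \<or> P n m" using C that by (auto simp: Chains_def relation_of_def)
          hence "\<exists>l\<in>C. (\<forall>x. l x \<le> m x) \<and> (\<forall>x. l x \<le> n x)"
            using that unfolding P_def by auto
          then obtain l where l: "l \<in> C" "\<And>x. l x \<le> m x" "\<And>x. l x \<le> n x" by blast
          have "u (x + y) \<le> l (x + y)" by (rule le[OF l(1)])
          also have "\<dots> \<le> l x + l y" using l(1) CA by (auto simp: A_def intro: sublinear_add)
          also have "\<dots> \<le> m x + n y" using l by (intro add_mono) auto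
          finally show ?thesis .
        qed
        have "u (x + y) - m x \<le> u y" if "m \<in> C" for m
          using *[OF that] by (intro ge) (simp add: algebra_simps)
        hence "u (x + y) - u y \<le> u x"
          by (intro ge) (simp add: algebra_simps)
        thus ?thesis by simp
      qed
      moreover have "u (t *\<^sub>R x) = t * u x" if "0 \<le> t" for t x
      proof (cases "t = 0")
        case True
        have "u 0 = 0"
        proof (rule antisym)
          obtain m where m: "m \<in> C" using False by blast
          show "u 0 \<le> 0" using le[OF m, of 0] m CA by (auto simp: A_def sublinear_zero)
          show "0 \<le> u 0" using CA by (intro ge) (auto simp: A_def sublinear_zero)
        qed
        thus ?thesis using True by simp
      next
        case t: False
        have hom: "m (t *\<^sub>R x) = t * m x" if "m \<in> C" for m
          using that CA \<open>0 \<le> t\<close> by (auto simp: A_def sublinear_scale)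
        have "t * u x \<le> u (t *\<^sub>R x)"
          using le[of _ x] \<open>0 \<le> t\<close> by (intro ge) (simp add: hom mult_left_mono)
        moreover have "u (t *\<^sub>R x) / t \<le> u x"
          using le[of _ "t *\<^sub>R x"] \<open>0 \<le> t\<close> t by (intro ge) (simp add: hom field_simps)
        hence "u (t *\<^sub>R x) \<le> t * u x"
          using \<open>0 \<le> t\<close> t by (simp add: field_simps)
        ultimately show ?thesis by simp
      qed
      ultimately have "sublinear u" by (simp add: sublinear_def)
      moreover have "u x \<le> q x" for x
      proof -
        obtain m where m: "m \<in> C" using False by blast
        hence "m x \<le> q x" using CA by (auto simp: A_def)
        thus ?thesis using le[OF m, of x] by simp
      qed
      ultimately show ?thesis using le by (auto simp: A_def P_def intro!: bexI[of _ u])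
    qed
  qed
  then obtain m where m: "m \<in> A" and min: "\<And>a. a \<in> A \<Longrightarrow> P m a \<Longrightarrow> a = m" by blast
  have sub: "sublinear m" and mq: "\<And>x. m x \<le> q x" using m by (auto simp: A_def)
  \<comment> \<open>Lowering \<open>m\<close> along \<open>z\<close> gives nothing new by
    minimality, so \<open>m (- z) \<le> - m z\<close>; the converse is
    \<open>sublinear_minus\<close>.\<close>
  have minus: "m (- z) = - m z" for z
  proof -
    obtain m' where m': "sublinear m'" "\<And>x. m' x \<le> m x" "m' (- z) \<le> - m z"
      using sublinear_directional[OF sub, of z] by metis
    have "m' = m"
      using m' mq by (intro min) (auto simp: A_def P_def intro: order_trans)
    thus ?thesis using m'(3) sublinear_minus[OF sub, of z] by simp
  qed
  have "linear m"
  proof (rule linearI)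
    fix x y
    show "m (x + y) = m x + m y"
      using sublinear_add[OF sub, of x y] sublinear_add[OF sub, of "- x" "- y"]
        minus[of x] minus[of y] minus[of "x + y"] by simp
  next
    fix c x
    show "m (c *\<^sub>R x) = c *\<^sub>R m x"
      using sublinear_scale[OF sub, of c x] sublinear_scale[OF sub, of "- c" x] minus[of "c *\<^sub>R x"]
      by (cases "0 \<le> c") auto
  qed
  thus thesis using mq that by blast
qed

text \<open>With the norm lowered along \<open>v\<close>, every linear functional below it satisfies
  \<open>m (- v) \<le> - norm v\<close>, hence attains the norm at \<open>v\<close>.\<close>

theorem norming_functional:
  fixes v :: "'a::real_normed_vector"
  obtains f :: "'a \<Rightarrow>\<^sub>L real" where "norm f \<le> 1" "f v = norm v"
proof -
  have "sublinear (norm :: 'a \<Rightarrow> real)"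
    by (auto simp: sublinear_def norm_triangle_ineq)
  then obtain q :: "'a \<Rightarrow> real" where q: "sublinear q" "\<And>x. q x \<le> norm x" "q (- v) \<le> - norm v"
    using sublinear_directional[of norm v] by metis
  obtain m where m: "linear m" "\<And>x. m x \<le> q x"
    using sublinear_dominates_linear[OF q(1)] by metis
  have le: "m x \<le> norm x" for x
    using m(2)[of x] q(2)[of x] by simp
  have abs: "\<bar>m x\<bar> \<le> norm x" for x
    using le[of x] le[of "- x"] linear_neg[OF m(1), of x] by (simp add: abs_le_iff)
  have bl: "bounded_linear m"
    using m(1) abs by (intro bounded_linear_intro[of _ 1]) (auto simp: linear_add linear_cmul)
  define f where "f = Blinfun m"
  have f: "blinfun_apply f = m" by (simp add: f_def bounded_linear_Blinfun_apply[OF bl])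
  show thesis
  proof
    show "norm f \<le> 1" by (rule norm_blinfun_bound) (auto simp: f abs)
    have "norm v \<le> m v"
      using m(2)[of "- v"] q(3) linear_neg[OF m(1), of v] by simp
    thus "f v = norm v" using le[of v] by (simp add: f)
  qed
qed

text \<open>Uniform boundedness for the evaluations at \<open>v k\<close>: Baire's theorem on the
  dual gives a ball of functionals bounded uniformly in \<open>k\<close>, and norming functionals
  translate this back to the norms of the vectors.\<close>

theorem weakly_bounded_imp_bounded:
  fixes v :: "nat \<Rightarrow> 'a::real_normed_vector"
  assumes "\<And>f :: 'a \<Rightarrow>\<^sub>L real. \<exists>K. \<forall>k. \<bar>f (v k)\<bar> \<le> K"
  obtains R where "\<And>k. norm (v k) \<le> R"
proof -
  define C where "C j = {f :: 'a \<Rightarrow>\<^sub>L real. \<forall>k. \<bar>f (v k)\<bar> \<le> real j}" for j :: nat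
  have closed: "closed (C j)" for j
    unfolding C_def by (intro closed_Collect_all closed_Collect_le continuous_intros)
  have "f \<in> \<Union>(range C)" for f
  proof -
    obtain K where K: "\<And>k. \<bar>f (v k)\<bar> \<le> K" using assms by blast
    obtain j :: nat where "K \<le> real j" using real_arch_simple by blast
    thus ?thesis using K by (auto simp: C_def intro: order_trans)
  qed
  hence UN: "\<Union>(range C) = UNIV" by blast
  have "\<exists>j. interior (C j) \<noteq> {}"
  proof (rule ccontr)
    assume "\<not> ?thesis"
    hence "euclidean interior_of \<Union>(range C) = {}"
      using closed completely_metrizable_space_euclidean
      by (intro Baire_category_alt) auto
    thus False by (simp add: UN)
  qed
  then obtain j f0 where "f0 \<in> interior (C j)" by blast
  then obtain e where e: "e > 0" "ball f0 e \<subseteq> C j" by (auto simp: mem_interior)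
  \<comment> \<open>Both \<open>f0\<close> and \<open>f0 + (e / 2) *\<^sub>R f\<close> lie in
    \<open>C j\<close>, so their difference is at most \<open>2 * j\<close> at
    \<open>v k\<close>.\<close>
  have "norm (v k) \<le> 4 * real j / e" for k
  proof -
    obtain f :: "'a \<Rightarrow>\<^sub>L real" where f: "norm f \<le> 1" "f (v k) = norm (v k)"
      by (rule norming_functional)
    have "f0 + (e / 2) *\<^sub>R f \<in> ball f0 e"
      using e(1) f(1) by (simp add: dist_norm)
    hence "\<bar>(f0 + (e / 2) *\<^sub>R f) (v k)\<bar> \<le> j" using e(2) by (auto simp: C_def)
    moreover have "f0 \<in> C j" using e by (simp add: subset_iff)
    hence "\<bar>f0 (v k)\<bar> \<le> j" by (simp add: C_def)
    ultimately have "e / 2 * norm (v k) \<le> 2 * j"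
      by (simp add: blinfun.add_left blinfun.scaleR_left f(2))
    thus ?thesis using e(1) by (simp add: field_simps)
  qed
  thus thesis by (rule that)
qed

section \<open>Finite families of linear functionals and finite dimension\<close>

lemma codimension_finite_functionals:
  fixes Y :: "('a::real_vector \<Rightarrow> real) set"
  assumes "finite Y" "\<And>y. y \<in> Y \<Longrightarrow> linear y"
  shows "\<exists>B. finite B \<and> (\<forall>x. \<exists>b\<in>span B. \<forall>y\<in>Y. y (x - b) = 0)"
  using assms
proof (induction Y rule: finite_induct)
  case empty
  show ?case by (rule exI[of _ "{}"]) auto
next
  case (insert y Y)
  then obtain B where B: "finite B" "\<And>x. \<exists>b\<in>span B. \<forall>y\<in>Y. y (x - b) = 0" by auto
  have lin: "linear y" "\<And>u. u \<in> Y \<Longrightarrow> linear u" using insert.prems by auto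
  show ?case
  \<comment> \<open>Either \<open>y\<close> is nonzero at some \<open>z\<close> in the common kernel
    of \<open>Y\<close>, and a multiple of \<open>z\<close> corrects the value of \<open>y\<close>
    without disturbing the others, or \<open>y\<close> vanishes there and the old \<open>B\<close>
    still works.\<close>
  proof (cases "\<exists>z. (\<forall>u\<in>Y. u z = 0) \<and> y z \<noteq> 0")
    case True
    then obtain z where z: "\<And>u. u \<in> Y \<Longrightarrow> u z = 0" "y z \<noteq> 0" by blast
    have "\<exists>b\<in>span (insert z B). \<forall>u\<in>insert y Y. u (x - b) = 0" for x
    proof -
      obtain b where b: "b \<in> span B" "\<And>u. u \<in> Y \<Longrightarrow> u (x - b) = 0" using B(2) by blast
      define c where "c = y (x - b) / y z"
      have "b + c *\<^sub>R z \<in> span (insert z B)"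
        using b(1) span_mono[of B "insert z B"] by (intro span_add span_scale) (auto intro: span_base)
      moreover have "u (x - (b + c *\<^sub>R z)) = 0" if "u \<in> insert y Y" for u
      proof -
        have "linear u" using that insert.prems by blast
        hence "u (x - (b + c *\<^sub>R z)) = u (x - b) - c * u z"
          by (simp add: linear_diff linear_add linear_cmul)
        thus ?thesis using that b(2)[of u] z(1)[of u] z(2) by (auto simp: c_def)
      qed
      ultimately show ?thesis by blast
    qed
    thus ?thesis using B(1) by (intro exI[of _ "insert z B"]) auto
  next
    case False
    thus ?thesis using B by (intro exI[of _ B]) (metis insert_iff)
  qed
qed

lemma span_UNIV_if_functionals_separate:
  fixes Y :: "('a::real_vector \<Rightarrow> real) set"
  assumes "finite Y" "\<And>y. y \<in> Y \<Longrightarrow> linear y" "\<And>x. (\<And>y. y \<in> Y \<Longrightarrow> y x = 0) \<Longrightarrow> x = 0"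
  shows "\<exists>B :: 'a set. finite B \<and> span B = UNIV"
proof -
  obtain B where B: "finite B" "\<And>x. \<exists>b\<in>span B. \<forall>y\<in>Y. y (x - b) = 0"
    using codimension_finite_functionals[OF assms(1,2)] by blast
  have "x \<in> span B" for x
  proof -
    obtain b where b: "b \<in> span B" "\<forall>y\<in>Y. y (x - b) = 0" using B(2) by blast
    have "x - b = 0" by (rule assms(3)) (use b(2) in blast)
    thus ?thesis using b(1) by simp
  qed
  thus ?thesis using B(1) by blast
qed

text \<open>The separation criterion is applied to the dual as the vector space; the separating
  functionals on it are the evaluations at a finite spanning set of \<open>'a\<close>.\<close>

lemma finite_dimensional_dual:
  assumes "finite_dimensional TYPE('a::banach)"
  shows "\<exists>Y :: ('a \<Rightarrow>\<^sub>L real) set. finite Y \<and> span Y = UNIV"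
proof -
  obtain B :: "'a set" where B: "finite B" "span B = UNIV"
    using assms by (auto simp: finite_dimensional_def)
  let ?Y = "(\<lambda>b (f :: 'a \<Rightarrow>\<^sub>L real). f b) ` B"
  show ?thesis
  proof (rule span_UNIV_if_functionals_separate)
    show "finite ?Y" using B(1) by simp
    show "linear y" if "y \<in> ?Y" for y
      using that by (auto intro!: linearI simp: blinfun.add_left blinfun.scaleR_left)
    show "f = 0" if "\<And>y. y \<in> ?Y \<Longrightarrow> y f = 0" for f :: "'a \<Rightarrow>\<^sub>L real"
    proof (rule blinfun_eqI)
      fix x
      have "linear (blinfun_apply f)" "linear (\<lambda>x::'a. 0::real)"
        by (simp_all add: linear_iff blinfun.add_right blinfun.scaleR_right)
      moreover have "f b = 0" if "b \<in> B" for b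
        using \<open>\<And>y. y \<in> ?Y \<Longrightarrow> y f = 0\<close>[of "\<lambda>f. f b"] that by auto
      ultimately have "f x = (\<lambda>x. 0) x"
        using B(2) by (intro linear_eq_on_span[of f "\<lambda>x. 0" B x]) auto
      thus "f x = blinfun_apply 0 x" by simp
    qed
  qed
qed

lemma infinite_dimensional_common_kernel:
  fixes Y :: "('a::banach \<Rightarrow>\<^sub>L real) set"
  assumes "\<not> finite_dimensional TYPE('a)" "finite Y"
  shows "\<exists>x. x \<noteq> 0 \<and> (\<forall>y\<in>Y. y x = 0)"
proof (rule ccontr)
  assume "\<not> ?thesis"
  hence *: "x = 0" if "\<And>y. y \<in> Y \<Longrightarrow> y x = 0" for x using that by blast
  have "\<exists>B :: 'a set. finite B \<and> span B = UNIV"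
  proof (rule span_UNIV_if_functionals_separate)
    show "finite (blinfun_apply ` Y)" using assms(2) by simp
    show "linear y" if "y \<in> blinfun_apply ` Y" for y
      using that by (auto simp: bounded_linear.linear blinfun.bounded_linear_right)
  qed (use * in auto)
  thus False using assms(1) by (auto simp: finite_dimensional_def)
qed

section \<open>Unit vectors on which functionals are small on average\<close>

definition triangular_system :: "nat \<Rightarrow> (nat \<Rightarrow> 'a::real_normed_vector) \<Rightarrow> (nat \<Rightarrow> 'a \<Rightarrow>\<^sub>L real) \<Rightarrow> bool" where
  "triangular_system n e h \<longleftrightarrow>
     (\<forall>k<n. norm (h k) \<le> 1 \<and> h k (e k) = 1) \<and> (\<forall>k<n. \<forall>i<k. h i (e k) = 0)"

text \<open>The next vector is taken in the common kernel of the functionals chosen so far, and the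
  next functional norms it. The values of a functional at earlier vectors stay uncontrolled, so the
  system is triangular rather than biorthogonal.\<close>

lemma triangular_system_exists:
  assumes "\<not> finite_dimensional TYPE('a::banach)"
  shows "\<exists>(e :: nat \<Rightarrow> 'a) h. (\<forall>k<n. norm (e k) = 1) \<and> triangular_system n e h"
proof (induction n)
  case 0
  show ?case by (simp add: triangular_system_def)
next
  case (Suc n)
  then obtain e :: "nat \<Rightarrow> 'a" and h where eh: "\<And>k. k < n \<Longrightarrow> norm (e k) = 1" "triangular_system n e h"
    by blast
  obtain z :: 'a where z: "z \<noteq> 0" "\<And>i. i < n \<Longrightarrow> h i z = 0"
    using infinite_dimensional_common_kernel[OF assms, of "h ` {..<n}"] by auto
  define v where "v = sgn z"
  have v: "norm v = 1" "\<And>i. i < n \<Longrightarrow> h i v = 0"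
    using z by (auto simp: v_def norm_sgn sgn_div_norm blinfun.scaleR_right)
  obtain f :: "'a \<Rightarrow>\<^sub>L real" where f: "norm f \<le> 1" "f v = norm v"
    by (rule norming_functional)
  have "triangular_system (Suc n) (e(n := v)) (h(n := f))"
    using eh(2) f v by (auto simp: triangular_system_def less_Suc_eq)
  moreover have "\<forall>k<Suc n. norm ((e(n := v)) k) = 1"
    using eh(1) v(1) by (simp add: less_Suc_eq)
  ultimately show ?case by blast
qed

text \<open>Applying \<open>h k\<close> to the sum kills the terms after \<open>k\<close>, so
  \<open>a k\<close> is at most the norm of the sum plus the earlier coefficients in absolute value.
  The recursion \<open>1 + (\<Sum>i<k. 2 ^ i) = 2 ^ k\<close> gives the constant.\<close>

lemma triangular_coefficient_bound:
  fixes e :: "nat \<Rightarrow> 'a::real_normed_vector"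
  assumes tri: "triangular_system n e h" and unit: "\<And>k. k < n \<Longrightarrow> norm (e k) = 1" and "k < n"
  shows "\<bar>a k\<bar> \<le> 2 ^ k * norm (\<Sum>i<n. a i *\<^sub>R e i)"
  using \<open>k < n\<close>
proof (induction k rule: less_induct)
  case (less k)
  let ?x = "\<Sum>i<n. a i *\<^sub>R e i"
  have h: "norm (h k) \<le> 1" "h k (e k) = 1" "\<And>i. k < i \<Longrightarrow> i < n \<Longrightarrow> h k (e i) = 0"
    using tri less.prems by (auto simp: triangular_system_def)
  have dual: "\<bar>h k x\<bar> \<le> norm x" for x
    using norm_blinfun[of "h k" x] h(1) mult_right_mono[OF h(1), of "norm x"] by simp
  have "h k ?x = (\<Sum>i<n. a i * h k (e i))"
    by (simp add: blinfun.sum_right blinfun.scaleR_right)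
  also have "\<dots> = (\<Sum>i<Suc k. a i * h k (e i))"
    using less.prems h(3) by (intro sum.mono_neutral_right) auto
  finally have "a k = h k ?x - (\<Sum>i<k. a i * h k (e i))" using h(2) by simp
  also have "\<bar>\<dots>\<bar> \<le> \<bar>h k ?x\<bar> + (\<Sum>i<k. \<bar>a i * h k (e i)\<bar>)"
    by (intro order_trans[OF abs_triangle_ineq4] add_mono sum_abs order_refl)
  also have "\<dots> \<le> norm ?x + (\<Sum>i<k. 2 ^ i * norm ?x)"
  proof (intro add_mono sum_mono dual)
    fix i assume i: "i \<in> {..<k}"
    have "\<bar>h k (e i)\<bar> \<le> 1" using dual[of "e i"] unit[of i] i less.prems by simp
    hence "\<bar>a i * h k (e i)\<bar> \<le> \<bar>a i\<bar>" by (simp add: abs_mult mult_left_le)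
    thus "\<bar>a i * h k (e i)\<bar> \<le> 2 ^ i * norm ?x" using less.IH[of i] i less.prems by simp
  qed
  also have "\<dots> = (1 + (\<Sum>i<k. 2 ^ i)) * norm ?x"
    by (simp add: sum_distrib_right algebra_simps)
  also have "(1 + (\<Sum>i<k. 2 ^ i)) = (2::real) ^ k"
    by (induction k) auto
  finally show ?case .
qed

lemma span_image_lessThan:
  fixes e :: "nat \<Rightarrow> 'a::real_vector"
  assumes "x \<in> span (e ` {..<n})"
  shows "\<exists>a. x = (\<Sum>i<n. a i *\<^sub>R e i)"
  using assms
proof (induction n arbitrary: x)
  case (Suc n)
  then obtain c where "x - c *\<^sub>R e n \<in> span (e ` {..<n})"
    by (auto simp: lessThan_Suc span_breakdown_eq)
  then obtain a where a: "x - c *\<^sub>R e n = (\<Sum>i<n. a i *\<^sub>R e i)"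
    using Suc.IH by blast
  have "(\<Sum>i<Suc n. (a(n := c)) i *\<^sub>R e i) = (\<Sum>i<n. a i *\<^sub>R e i) + c *\<^sub>R e n"
    by simp
  also have "\<dots> = x" by (simp flip: a)
  finally show ?case by metis
qed simp

text \<open>A dependence would be a vanishing combination of the first \<open>Suc k\<close> vectors
  with coefficient \<open>- 1\<close> at \<open>k\<close>, against the coefficient bound.\<close>

lemma triangular_notin_span:
  fixes e :: "nat \<Rightarrow> 'a::real_normed_vector"
  assumes tri: "triangular_system n e h" and unit: "\<And>k. k < n \<Longrightarrow> norm (e k) = 1" and "k < n"
  shows "e k \<notin> span (e ` {..<k})"
proof
  assume "e k \<in> span (e ` {..<k})"
  then obtain a where a: "e k = (\<Sum>i<k. a i *\<^sub>R e i)"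
    using span_image_lessThan by blast
  have "triangular_system (Suc k) e h"
    using tri \<open>k < n\<close> by (auto simp: triangular_system_def)
  hence "\<bar>(a(k := - 1)) k\<bar> \<le> 2 ^ k * norm (\<Sum>i<Suc k. (a(k := - 1)) i *\<^sub>R e i)"
    using unit \<open>k < n\<close> by (intro triangular_coefficient_bound) auto
  thus False using a by simp
qed

text \<open>The approximation is required only on the span of the \<open>e i\<close>, where a
  functional is determined by \<open>n\<close> numbers in \<open>[-1, 1]\<close>. Rounding these to
  multiples of a mesh leaves finitely many classes, and the coefficient bound turns closeness at the
  \<open>e i\<close> into closeness on the span.\<close>

lemma dual_ball_net:
  fixes e :: "nat \<Rightarrow> 'a::real_normed_vector"
  assumes tri: "triangular_system n e h" and unit: "\<And>k. k < n \<Longrightarrow> norm (e k) = 1"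
    and "0 < \<delta>"
  obtains N :: "('a \<Rightarrow>\<^sub>L real) set" where "finite N" "N \<noteq> {}" "\<And>f. f \<in> N \<Longrightarrow> norm f \<le> 1"
    "\<And>g. norm g \<le> 1 \<Longrightarrow> \<exists>f\<in>N. \<forall>x\<in>span (e ` {..<n}). \<bar>blinfun_apply g x - blinfun_apply f x\<bar> \<le> \<delta> * norm x"
proof -
  \<comment> \<open>The factor \<open>2 ^ n\<close> absorbs the sum of the coefficient bounds
    \<open>2 ^ i\<close> for \<open>i < n\<close>.\<close>
  define \<eta> where "\<eta> = \<delta> / 2 ^ n"
  have \<eta>: "0 < \<eta>" using \<open>0 < \<delta>\<close> by (simp add: \<eta>_def)
  define \<kappa> where "\<kappa> f = (\<lambda>i\<in>{..<n}. \<lfloor>f (e i) / \<eta>\<rfloor>)" for f :: "'a \<Rightarrow>\<^sub>L real"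
  let ?ball = "{f :: 'a \<Rightarrow>\<^sub>L real. norm f \<le> 1}"
  have le1: "\<bar>f (e i)\<bar> \<le> 1" if "norm f \<le> 1" "i < n" for f :: "'a \<Rightarrow>\<^sub>L real" and i
    using norm_blinfun[of f "e i"] that unit[of i] by simp
  have "\<kappa> ` ?ball \<subseteq> {..<n} \<rightarrow>\<^sub>E {\<lfloor>- 1 / \<eta>\<rfloor>..\<lfloor>1 / \<eta>\<rfloor>}"
  proof (rule image_subsetI)
    fix f :: "'a \<Rightarrow>\<^sub>L real" assume "f \<in> ?ball"
    hence f: "norm f \<le> 1" by simp
    have "\<lfloor>f (e i) / \<eta>\<rfloor> \<in> {\<lfloor>- 1 / \<eta>\<rfloor>..\<lfloor>1 / \<eta>\<rfloor>}" if "i < n" for i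
      using le1[OF f that] \<eta> by (auto intro!: floor_mono simp: abs_le_iff field_simps)
    thus "\<kappa> f \<in> {..<n} \<rightarrow>\<^sub>E {\<lfloor>- 1 / \<eta>\<rfloor>..\<lfloor>1 / \<eta>\<rfloor>}" by (auto simp: \<kappa>_def)
  qed
  hence "finite (\<kappa> ` ?ball)" by (rule finite_subset) (auto intro: finite_PiE)
  \<comment> \<open>Finitely many functionals of the ball realise all rounding patterns that occur
    in it.\<close>
  then obtain N where N: "N \<subseteq> ?ball" "finite N" "\<kappa> ` ?ball = \<kappa> ` N"
    using finite_subset_image[of "\<kappa> ` ?ball" \<kappa> ?ball] by auto
  have "0 \<in> ?ball" by simp
  show thesis
  proof (rule that[of N])
    show "finite N" by fact
    show "N \<noteq> {}" using N(3) \<open>0 \<in> ?ball\<close> by blast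
    show "norm f \<le> 1" if "f \<in> N" for f using N(1) that by blast
    show "\<exists>f\<in>N. \<forall>x\<in>span (e ` {..<n}). \<bar>g x - f x\<bar> \<le> \<delta> * norm x" if "norm g \<le> 1" for g :: "'a \<Rightarrow>\<^sub>L real"
    proof -
      have "\<kappa> g \<in> \<kappa> ` N" using N(3) that by blast
      then obtain f where f: "f \<in> N" "\<kappa> g = \<kappa> f" by blast
      have close: "\<bar>g (e i) - f (e i)\<bar> \<le> \<eta>" if "i < n" for i
      proof -
        have "\<lfloor>g (e i) / \<eta>\<rfloor> = \<lfloor>f (e i) / \<eta>\<rfloor>"
          using fun_cong[OF f(2), of i] that by (simp add: \<kappa>_def)
        hence "\<bar>g (e i) / \<eta> - f (e i) / \<eta>\<bar> \<le> 1" by linarith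
        thus ?thesis using \<eta> by (simp add: field_simps flip: diff_divide_distrib)
      qed
      have "\<bar>g x - f x\<bar> \<le> \<delta> * norm x" if x: "x \<in> span (e ` {..<n})" for x
      proof -
        obtain a where a: "x = (\<Sum>i<n. a i *\<^sub>R e i)" using span_image_lessThan[OF x] by blast
        have "g x - f x = (\<Sum>i<n. a i * (g (e i) - f (e i)))"
          by (simp add: a blinfun.sum_right blinfun.scaleR_right sum_subtractf algebra_simps)
        also have "\<bar>\<dots>\<bar> \<le> (\<Sum>i<n. \<bar>a i * (g (e i) - f (e i))\<bar>)" by (rule sum_abs)
        also have "\<dots> \<le> (\<Sum>i<n. (2 ^ i * norm x) * \<eta>)"
        proof (rule sum_mono)
          fix i assume "i \<in> {..<n}"
          hence i: "i < n" by simp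
          have "\<bar>a i\<bar> \<le> 2 ^ i * norm x"
            unfolding a by (rule triangular_coefficient_bound[OF tri unit i])
          thus "\<bar>a i * (g (e i) - f (e i))\<bar> \<le> (2 ^ i * norm x) * \<eta>"
            unfolding abs_mult using close[OF i] by (intro mult_mono) auto
        qed
        also have "\<dots> = (\<Sum>i<n. 2 ^ i) * (norm x * \<eta>)"
          by (simp add: sum_distrib_right mult.assoc)
        also have "\<dots> \<le> 2 ^ n * (norm x * \<eta>)"
        proof (intro mult_right_mono)
          have "(\<Sum>i<n. 2 ^ i) = (2::real) ^ n - 1" by (induction n) auto
          thus "(\<Sum>i<n. 2 ^ i) \<le> (2::real) ^ n" by simp
        qed (use \<eta> in auto)
        also have "\<dots> = \<delta> * norm x" by (simp add: \<eta>_def)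
        finally show ?thesis .
      qed
      thus ?thesis using f(1) by blast
    qed
  qed
qed

text \<open>If \<open>c \<cdot> \<parallel>x\<parallel>\<^sup>2 \<le> \<langle>x, x\<rangle>\<close> held on the span for the form \<open>\<langle>x, y\<rangle> = \<Sum>w\<^sub>f f(x) f(y)\<close>, then for a
  \<open>\<langle>\<cdot>, \<cdot>\<rangle>\<close>-orthonormal basis \<open>u\<close> each \<open>\<Sum>\<^sub>i f(u\<^sub>i)\<^sup>2\<close> would be at most \<open>1 / c\<close>, whereas their
  \<open>w\<close>-weighted sum is the dimension \<open>n\<close>.\<close>

lemma weighted_functionals_bound:
  fixes e :: "nat \<Rightarrow> 'a::real_normed_vector"
  assumes "finite N" and ball: "\<And>f. f \<in> N \<Longrightarrow> norm f \<le> 1" and w: "\<And>f. f \<in> N \<Longrightarrow> 0 \<le> w f"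
    and indep: "\<And>k. k < n \<Longrightarrow> e k \<notin> span (e ` {..<k})"
    and "0 < c"
    and lower: "\<And>x. x \<in> span (e ` {..<n}) \<Longrightarrow> c * (norm x)\<^sup>2 \<le> (\<Sum>f\<in>N. w f * (blinfun_apply f x)\<^sup>2)"
  shows "real n * c \<le> (\<Sum>f\<in>N. w f)"
proof -
  define ip where "ip x y = (\<Sum>f\<in>N. w f * (blinfun_apply f x * blinfun_apply f y))" for x y :: 'a
  have ip_commute: "ip x y = ip y x" for x y by (simp add: ip_def mult.commute)
  have ip_diff: "ip (x - x') y = ip x y - ip x' y" for x x' y
    by (simp add: ip_def blinfun.diff_right algebra_simps sum_subtractf)
  have ip_scale: "ip (r *\<^sub>R x) y = r * ip x y" for r x y
    by (simp add: ip_def blinfun.scaleR_right sum_distrib_left algebra_simps)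
  have ip_scale_right: "ip y (r *\<^sub>R x) = r * ip y x" for r x y
    using ip_scale[of r x y] by (simp only: ip_commute)
  have ip_sum: "ip (sum g I) y = (\<Sum>i\<in>I. ip (g i) y)" for g :: "nat \<Rightarrow> 'a" and I y
    by (simp add: ip_def blinfun.sum_right sum_distrib_left sum_distrib_right sum.swap[of _ _ I])
  have low: "c * (norm x)\<^sup>2 \<le> ip x x" if "x \<in> span (e ` {..<n})" for x
    using lower[OF that] by (simp add: ip_def power2_eq_square)
  \<comment> \<open>Gram-Schmidt for \<open>ip\<close>. On the span, \<open>low\<close> makes the
    form definite, while \<open>indep\<close> makes the new vector \<open>v\<close> nonzero, so it
    can be normalised.\<close>
  have "\<exists>u. \<forall>i<k. u i \<in> span (e ` {..<k}) \<and> (\<forall>j<k. ip (u i) (u j) = (if i = j then 1 else 0))"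
    if "k \<le> n" for k
    using that
  proof (induction k)
    case (Suc k)
    then obtain u where u: "\<And>i. i < k \<Longrightarrow> u i \<in> span (e ` {..<k})"
      "\<And>i j. i < k \<Longrightarrow> j < k \<Longrightarrow> ip (u i) (u j) = (if i = j then 1 else 0)" by auto
    define s where "s = (\<Sum>i<k. ip (e k) (u i) *\<^sub>R u i)"
    define v where "v = e k - s"
    have mono: "span (e ` {..<j}) \<subseteq> span (e ` {..<j'})" if "j \<le> j'" for j j'
      using that by (intro span_mono image_mono) auto
    have s: "s \<in> span (e ` {..<k})"
      unfolding s_def by (intro span_sum span_scale u) auto
    have "v \<noteq> 0" using s indep[of k] Suc.prems by (auto simp: v_def)
    have v: "v \<in> span (e ` {..<Suc k})"
      unfolding v_def using s mono[of k "Suc k"] by (intro span_diff[OF span_base]) auto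
    have orth: "ip v (u j) = 0" if "j < k" for j
      using that by (simp add: v_def s_def ip_diff ip_sum ip_scale u(2) if_distrib sum.delta' cong: if_cong)
    define q where "q = ip v v"
    have "0 < c * (norm v)\<^sup>2" using \<open>0 < c\<close> \<open>v \<noteq> 0\<close> by simp
    also have "\<dots> \<le> q" unfolding q_def using v mono[of "Suc k" n] Suc.prems by (intro low) auto
    finally have q: "0 < q" .
    define u' where "u' = u(k := (1 / sqrt q) *\<^sub>R v)"
    have "u' i \<in> span (e ` {..<Suc k})" if "i < Suc k" for i
    proof (cases "i = k")
      case True
      thus ?thesis using span_scale[OF v] by (simp add: u'_def)
    next
      case False
      hence "u i \<in> span (e ` {..<k})" using that by (intro u) simp
      thus ?thesis using False subsetD[OF mono[of k "Suc k"]] by (simp add: u'_def)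
    qed
    moreover have "ip (u' i) (u' j) = (if i = j then 1 else 0)" if "i < Suc k" "j < Suc k" for i j
    proof -
      have "ip ((1 / sqrt q) *\<^sub>R v) ((1 / sqrt q) *\<^sub>R v) = 1"
        using q by (simp add: ip_scale ip_scale_right flip: q_def)
      moreover have "ip ((1 / sqrt q) *\<^sub>R v) (u l) = 0" "ip (u l) ((1 / sqrt q) *\<^sub>R v) = 0" if "l < k" for l
        using orth[OF that] ip_commute[of "u l" v] by (simp_all add: ip_scale ip_scale_right)
      ultimately show ?thesis using that u(2) by (auto simp: u'_def less_Suc_eq)
    qed
    ultimately show ?case by blast
  qed simp
  from this[of n] obtain u where u: "\<And>i. i < n \<Longrightarrow> u i \<in> span (e ` {..<n})"
    "\<And>i j. i < n \<Longrightarrow> j < n \<Longrightarrow> ip (u i) (u j) = (if i = j then 1 else 0)" by auto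
  \<comment> \<open>The vector \<open>x\<close> below represents \<open>f\<close> on the span:
    \<open>f x = ip x x = S\<close>. Then \<open>low\<close> gives
    \<open>c * (norm x)\<^sup>2 \<le> S\<close>, whereas \<open>norm f \<le> 1\<close> gives
    \<open>S \<le> norm x\<close>, so \<open>c * S\<^sup>2 \<le> S\<close>.\<close>
  have S_le: "(\<Sum>i<n. (blinfun_apply f (u i))\<^sup>2) \<le> 1 / c" if "f \<in> N" for f
  proof -
    define S where "S = (\<Sum>i<n. (f (u i))\<^sup>2)"
    define x where "x = (\<Sum>i<n. f (u i) *\<^sub>R u i)"
    have x: "x \<in> span (e ` {..<n})" unfolding x_def by (intro span_sum span_scale u) auto
    have S0: "0 \<le> S" by (simp add: S_def sum_nonneg)
    have fx: "f x = S"
      by (simp add: x_def S_def blinfun.sum_right blinfun.scaleR_right power2_eq_square)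
    have proj: "ip x (u j) = f (u j)" if "j < n" for j
      using that by (simp add: x_def ip_sum ip_scale u(2) if_distrib sum.delta' cong: if_cong)
    have "ip x x = (\<Sum>i<n. ip (f (u i) *\<^sub>R u i) x)"
      using ip_sum[of "\<lambda>i. f (u i) *\<^sub>R u i" "{..<n}" x] by (simp only: x_def[symmetric])
    also have "\<dots> = (\<Sum>i<n. f (u i) * ip x (u i))"
      by (simp only: ip_scale_right ip_commute[of _ x])
    also have "\<dots> = S" by (simp add: proj S_def power2_eq_square)
    finally have "c * (norm x)\<^sup>2 \<le> S" using low[OF x] by simp
    moreover have "S\<^sup>2 \<le> (norm x)\<^sup>2"
      using norm_blinfun[of f x] ball[OF that] mult_right_mono[OF ball[OF that], of "norm x"] S0
      by (intro power_mono) (auto simp: fx)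
    hence "c * S\<^sup>2 \<le> c * (norm x)\<^sup>2" using \<open>0 < c\<close> by simp
    ultimately have "(c * S) * S \<le> 1 * S" by (simp add: power2_eq_square mult.assoc)
    hence "c * S \<le> 1" using S0 \<open>0 < c\<close> by (cases "S = 0") (auto simp: mult_le_cancel_right)
    thus ?thesis using \<open>0 < c\<close> by (simp add: field_simps S_def)
  qed
  have "real n = (\<Sum>i<n. ip (u i) (u i))" by (simp add: u(2))
  also have "\<dots> = (\<Sum>f\<in>N. w f * (\<Sum>i<n. (blinfun_apply f (u i))\<^sup>2))"
    by (simp add: ip_def sum_distrib_left power2_eq_square sum.swap[of _ N])
  also have "\<dots> \<le> (\<Sum>f\<in>N. w f * (1 / c))"
    using S_le w by (intro sum_mono mult_left_mono) auto
  also have "\<dots> = (\<Sum>f\<in>N. w f) / c" by (simp add: sum_divide_distrib)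
  finally show ?thesis using \<open>0 < c\<close> by (simp add: field_simps)
qed

text \<open>If all unit vectors of the span exceeded the bound, homogeneity would give the
  hypothesis of \<open>weighted_functionals_bound\<close> with \<open>c = 2 / n * W\<close>, hence
  \<open>2 * W \<le> W\<close>; the factor \<open>2\<close> provides the contradiction.\<close>

lemma exists_unit_vector_small_average:
  fixes e :: "nat \<Rightarrow> 'a::real_normed_vector"
  assumes "finite N" "N \<noteq> {}" and ball: "\<And>f. f \<in> N \<Longrightarrow> norm f \<le> 1" and w: "\<And>f. f \<in> N \<Longrightarrow> 0 < w f"
    and indep: "\<And>k. k < n \<Longrightarrow> e k \<notin> span (e ` {..<k})" and "0 < n"
  obtains x where "x \<in> span (e ` {..<n})" "norm x = 1"
    "(\<Sum>f\<in>N. w f * (blinfun_apply f x)\<^sup>2) \<le> 2 / n * (\<Sum>f\<in>N. w f)"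
proof -
  define W where "W = (\<Sum>f\<in>N. w f)"
  define c where "c = 2 / n * W"
  have W: "0 < W" unfolding W_def using assms by (intro sum_pos) auto
  hence c: "0 < c" using \<open>0 < n\<close> by (simp add: c_def)
  have "\<exists>x\<in>span (e ` {..<n}). norm x = 1 \<and> (\<Sum>f\<in>N. w f * (blinfun_apply f x)\<^sup>2) \<le> c"
  proof (rule ccontr)
    assume no: "\<not> ?thesis"
    have "c * (norm x)\<^sup>2 \<le> (\<Sum>f\<in>N. w f * (blinfun_apply f x)\<^sup>2)" if x: "x \<in> span (e ` {..<n})" for x
    proof (cases "x = 0")
      case False
      define y where "y = (1 / norm x) *\<^sub>R x"
      have "y \<in> span (e ` {..<n})" "norm y = 1" using x False by (auto simp: y_def intro: span_scale)
      hence "c < (\<Sum>f\<in>N. w f * (blinfun_apply f y)\<^sup>2)" using no by force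
      also have "\<dots> = (\<Sum>f\<in>N. w f * (blinfun_apply f x)\<^sup>2) / (norm x)\<^sup>2"
        by (simp add: y_def blinfun.scaleR_right power_divide sum_divide_distrib)
      finally show ?thesis using False by (simp add: field_simps)
    qed simp
    hence "real n * c \<le> W" unfolding W_def
      using assms c by (intro weighted_functionals_bound[where e = e]) (auto intro: less_imp_le)
    thus False using W \<open>0 < n\<close> by (simp add: c_def)
  qed
  thus thesis using that by (auto simp: c_def W_def)
qed

text \<open>The weight of \<open>f\<close> after \<open>T\<close> rounds is the product of the
  factors \<open>1 + f(x t)^2\<close>. Each new vector is chosen against the current weights, so the
  total weight, initially \<open>card N\<close>, grows at most by the factor
  \<open>1 + 2 / n\<close> per round.\<close>

lemma multiplicative_weights:
  fixes e :: "nat \<Rightarrow> 'a::real_normed_vector"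
  assumes "finite N" "N \<noteq> {}" and ball: "\<And>f. f \<in> N \<Longrightarrow> norm f \<le> 1"
    and indep: "\<And>k. k < n \<Longrightarrow> e k \<notin> span (e ` {..<k})" and "0 < n"
  shows "\<exists>x. (\<forall>t<T. x t \<in> span (e ` {..<n}) \<and> norm (x t) = 1) \<and>
    (\<Sum>f\<in>N. \<Prod>t<T. 1 + (blinfun_apply f (x t))\<^sup>2) \<le> real (card N) * (1 + 2 / n) ^ T"
proof (induction T)
  case (Suc T)
  then obtain x where x: "\<And>t. t < T \<Longrightarrow> x t \<in> span (e ` {..<n}) \<and> norm (x t) = 1"
    "(\<Sum>f\<in>N. \<Prod>t<T. 1 + (blinfun_apply f (x t))\<^sup>2) \<le> real (card N) * (1 + 2 / n) ^ T" by blast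
  define w where "w f = (\<Prod>t<T. 1 + (blinfun_apply f (x t))\<^sup>2)" for f :: "'a \<Rightarrow>\<^sub>L real"
  have w: "0 < w f" for f unfolding w_def by (intro prod_pos) (simp add: add_pos_nonneg)
  obtain z where z: "z \<in> span (e ` {..<n})" "norm z = 1"
    "(\<Sum>f\<in>N. w f * (blinfun_apply f z)\<^sup>2) \<le> 2 / n * (\<Sum>f\<in>N. w f)"
    by (rule exists_unit_vector_small_average[OF assms(1-3) w assms(4,5)])
  define x' where "x' = x(T := z)"
  have "(\<Sum>f\<in>N. \<Prod>t<Suc T. 1 + (blinfun_apply f (x' t))\<^sup>2) = (\<Sum>f\<in>N. w f + w f * (blinfun_apply f z)\<^sup>2)"
    by (simp add: x'_def w_def algebra_simps)
  also have "\<dots> = (\<Sum>f\<in>N. w f) + (\<Sum>f\<in>N. w f * (blinfun_apply f z)\<^sup>2)"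
    by (rule sum.distrib)
  also have "\<dots> \<le> (1 + 2 / n) * (\<Sum>f\<in>N. w f)" using z(3) by (simp add: algebra_simps)
  also have "\<dots> \<le> (1 + 2 / n) * (real (card N) * (1 + 2 / n) ^ T)"
    using x(2) by (intro mult_left_mono) (auto simp: w_def)
  finally have "(\<Sum>f\<in>N. \<Prod>t<Suc T. 1 + (blinfun_apply f (x' t))\<^sup>2) \<le> real (card N) * (1 + 2 / n) ^ Suc T"
    by (simp add: algebra_simps)
  moreover have "\<forall>t<Suc T. x' t \<in> span (e ` {..<n}) \<and> norm (x' t) = 1"
    using x(1) z by (simp add: x'_def less_Suc_eq)
  ultimately show ?case by blast
qed simp

text \<open>The weight of one functional is at most the total weight; taking logarithms bounds its
  sum of squares over the vectors. Squares are then converted to absolute values, the net extends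
  the estimate to the dual ball, and scaling to all functionals. The dimension \<open>n\<close> is
  fixed first, then the net, then \<open>T\<close>.\<close>

theorem unit_vectors_scalarly_small:
  assumes "\<not> finite_dimensional TYPE('a::banach)" and "0 < \<epsilon>"
  shows "\<exists>T>0. \<exists>x :: nat \<Rightarrow> 'a. (\<forall>t<T. norm (x t) = 1) \<and>
    (\<forall>g :: 'a \<Rightarrow>\<^sub>L real. (\<Sum>t<T. \<bar>blinfun_apply g (x t)\<bar>) \<le> \<epsilon> * T * norm g)"
proof -
  \<comment> \<open>The net and the passage from squares to absolute values cost one \<delta> each,
    together \<open>\<epsilon> / 2\<close>. The remaining error \<open>6 / (n * \<delta>)\<close> is
    at most \<open>\<epsilon> / 2\<close> because
    \<open>n > 48 / \<epsilon>\<^sup>2\<close>.\<close>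
  define \<delta> where "\<delta> = \<epsilon> / 4"
  have \<delta>: "0 < \<delta>" using assms by (simp add: \<delta>_def)
  obtain n :: nat where n: "48 / \<epsilon>\<^sup>2 < n" using reals_Archimedean2 by blast
  hence "0 < n" using \<open>0 < \<epsilon>\<close> by (intro gr0I) (auto simp: field_simps)
  obtain e :: "nat \<Rightarrow> 'a" and h where unit: "\<And>k. k < n \<Longrightarrow> norm (e k) = 1" and tri: "triangular_system n e h"
    using triangular_system_exists[OF assms(1), of n] by blast
  obtain N :: "('a \<Rightarrow>\<^sub>L real) set" where N: "finite N" "N \<noteq> {}" "\<And>f. f \<in> N \<Longrightarrow> norm f \<le> 1"
    "\<And>g. norm g \<le> 1 \<Longrightarrow> \<exists>f\<in>N. \<forall>x\<in>span (e ` {..<n}). \<bar>blinfun_apply g x - blinfun_apply f x\<bar> \<le> \<delta> * norm x"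
    using dual_ball_net[OF tri unit \<delta>] by metis
  have cardN: "1 \<le> card N" using N(1,2) by (simp add: Suc_leI card_gt_0_iff)
  \<comment> \<open>So many rounds make the initial weight negligible:
    \<open>ln (card N) \<le> T / n\<close>. The successor keeps \<open>T\<close> positive when
    \<open>card N = 1\<close>.\<close>
  define T where "T = Suc (nat \<lceil>n * ln (card N)\<rceil>)"
  have T: "0 < T" "n * ln (card N) \<le> T" unfolding T_def by (simp, linarith)
  obtain x where x: "\<And>t. t < T \<Longrightarrow> x t \<in> span (e ` {..<n})" "\<And>t. t < T \<Longrightarrow> norm (x t) = 1"
    "(\<Sum>f\<in>N. \<Prod>t<T. 1 + (blinfun_apply f (x t))\<^sup>2) \<le> real (card N) * (1 + 2 / n) ^ T"
    using multiplicative_weights[OF N(1-3) triangular_notin_span[OF tri unit] \<open>0 < n\<close>, of T] by blast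
  \<comment> \<open>Half the sum will be at most \<open>ln (card N) + 2 * T / n\<close>, hence at
    most \<open>3 * T / n\<close>.\<close>
  have sq: "(\<Sum>t<T. (blinfun_apply f (x t))\<^sup>2) \<le> 6 * T / n" if f: "f \<in> N" for f
  proof -
    define z where "z t = (blinfun_apply f (x t))\<^sup>2" for t
    have z: "0 \<le> z t" "z t \<le> 1" if "t < T" for t
      using norm_blinfun[of f "x t"] N(3)[OF f] x(2)[OF that] by (auto simp: z_def abs_square_le_1)
    \<comment> \<open>This inequality on \<open>[0, 1]\<close> bounds the product of the factors
      \<open>1 + z t\<close> below by the exponential of half the sum.\<close>
    have "exp (z t / 2) \<le> 1 + z t" if "t < T" for t
    proof -
      have "exp (z t / 2) \<le> 1 + z t / 2 + (z t / 2)\<^sup>2" using z[OF that] by (intro exp_bound) auto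
      also have "(z t / 2)\<^sup>2 \<le> z t / 2"
        using mult_right_mono[OF z(2)[OF that] z(1)[OF that]] z[OF that]
        by (simp add: power2_eq_square)
      finally show ?thesis by simp
    qed
    hence "exp ((\<Sum>t<T. z t) / 2) \<le> (\<Prod>t<T. 1 + z t)"
      by (auto simp: sum_divide_distrib exp_sum intro!: prod_mono)
    also have "\<dots> \<le> (\<Sum>f\<in>N. \<Prod>t<T. 1 + (blinfun_apply f (x t))\<^sup>2)"
      unfolding z_def using f N(1) by (intro member_le_sum prod_nonneg) auto
    also have "\<dots> \<le> real (card N) * (1 + 2 / n) ^ T" by (rule x(3))
    also have "\<dots> \<le> real (card N) * exp (2 / n) ^ T"
      by (intro mult_left_mono power_mono exp_ge_add_one_self) auto
    also have "\<dots> = exp (ln (card N) + T * (2 / n))"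
      using cardN by (simp add: exp_add flip: exp_of_nat_mult)
    finally have "(\<Sum>t<T. z t) / 2 \<le> ln (card N) + T * (2 / n)" by simp
    also have "ln (card N) \<le> T / n" using T(2) \<open>0 < n\<close> by (simp add: field_simps)
    finally show ?thesis by (simp add: z_def field_simps)
  qed
  have key: "(\<Sum>t<T. \<bar>blinfun_apply g (x t)\<bar>) \<le> \<epsilon> * T" if "norm g \<le> 1" for g :: "'a \<Rightarrow>\<^sub>L real"
  proof -
    note g = that
    obtain f where f: "f \<in> N" "\<And>y. y \<in> span (e ` {..<n}) \<Longrightarrow> \<bar>blinfun_apply g y - blinfun_apply f y\<bar> \<le> \<delta> * norm y"
      using N(4)[OF g] by blast
    have "(\<Sum>t<T. \<bar>blinfun_apply g (x t)\<bar>) \<le> (\<Sum>t<T. 2 * \<delta> + (blinfun_apply f (x t))\<^sup>2 / \<delta>)"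
    proof (rule sum_mono)
      fix t assume "t \<in> {..<T}"
      hence t: "t < T" by simp
      define r where "r = blinfun_apply f (x t)"
      \<comment> \<open>Expanded and divided by \<delta>, this bounds \<open>\<bar>r\<bar>\<close>
        linearly by its square.\<close>
      have "0 \<le> (\<bar>r\<bar> - \<delta>)\<^sup>2 + \<delta> * \<bar>r\<bar>" using \<delta> by simp
      hence "\<delta> * \<bar>r\<bar> \<le> \<delta> * \<delta> + r\<^sup>2" by (simp add: power2_eq_square algebra_simps)
      hence "\<bar>r\<bar> \<le> \<delta> + r\<^sup>2 / \<delta>" using \<delta> by (simp add: field_simps)
      moreover have "\<bar>blinfun_apply g (x t) - r\<bar> \<le> \<delta>" using f(2)[OF x(1)[OF t]] x(2)[OF t] by (simp add: r_def)
      ultimately show "\<bar>blinfun_apply g (x t)\<bar> \<le> 2 * \<delta> + (blinfun_apply f (x t))\<^sup>2 / \<delta>"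
        unfolding r_def by linarith
    qed
    also have "\<dots> = 2 * \<delta> * T + (\<Sum>t<T. (blinfun_apply f (x t))\<^sup>2) / \<delta>"
      by (simp add: sum.distrib sum_divide_distrib)
    also have "\<dots> \<le> 2 * \<delta> * T + (6 * T / n) / \<delta>"
      using sq[OF f(1)] \<delta> by (intro add_left_mono divide_right_mono) auto
    also have "\<dots> = T * (2 * \<delta> + 6 / (n * \<delta>))" by (simp add: algebra_simps)
    also have "\<dots> \<le> T * \<epsilon>"
    proof (rule mult_left_mono)
      have "24 / \<epsilon> \<le> n * (\<epsilon> / 2)"
        using n \<open>0 < \<epsilon>\<close> by (simp add: field_simps power2_eq_square)
      hence "6 / (n * \<delta>) \<le> \<epsilon> / 2" using \<open>0 < n\<close> \<open>0 < \<epsilon>\<close> by (simp add: \<delta>_def field_simps)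
      thus "2 * \<delta> + 6 / (n * \<delta>) \<le> \<epsilon>" by (simp add: \<delta>_def)
    qed simp
    finally show ?thesis by (simp add: mult.commute)
  qed
  have "(\<Sum>t<T. \<bar>blinfun_apply g (x t)\<bar>) \<le> \<epsilon> * T * norm g" for g :: "'a \<Rightarrow>\<^sub>L real"
  proof (cases "g = 0")
    case False
    have "(\<Sum>t<T. \<bar>blinfun_apply (sgn g) (x t)\<bar>) \<le> \<epsilon> * T" by (rule key) (simp add: norm_sgn)
    moreover have "(\<Sum>t<T. \<bar>blinfun_apply (sgn g) (x t)\<bar>) = (\<Sum>t<T. \<bar>blinfun_apply g (x t)\<bar>) / norm g"
      by (simp add: sgn_div_norm blinfun.scaleR_left abs_mult sum_distrib_left divide_inverse_commute)
    ultimately show ?thesis using False by (simp add: field_simps)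
  qed simp
  thus ?thesis using T(1) x(2) by blast
qed

section \<open>Finite-dimensional spaces\<close>

lemma finite_measure_Omega: "finite_measure Omega"
  by (rule finite_measure_lebesgue_on) auto

lemma measure_Omega_space: "measure Omega (space Omega) = 1"
  by (simp add: measure_restrict_space)

text \<open>Completeness of Lebesgue measure, carried to the interval through extension by
  zero.\<close>

lemma borel_measurable_Omega_AE:
  fixes u v :: "real \<Rightarrow> real"
  assumes "u \<in> borel_measurable Omega" and "AE \<omega> in Omega. u \<omega> = v \<omega>"
  shows "v \<in> borel_measurable Omega"
proof -
  have "(\<lambda>\<omega>. if \<omega> \<in> {0..1} then u \<omega> else 0) \<in> borel_measurable lebesgue"
    using assms(1) by (subst borel_measurable_if) auto
  moreover have "AE \<omega> in lebesgue. (if \<omega> \<in> {0..1} then u \<omega> else 0) = (if \<omega> \<in> {0..1} then v \<omega> else 0)"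
    using assms(2) by (simp add: AE_restrict_space_iff)
  ultimately have "(\<lambda>\<omega>. if \<omega> \<in> {0..1} then v \<omega> else 0) \<in> borel_measurable lebesgue"
    by (rule borel_measurable_AE)
  thus ?thesis by (subst (asm) borel_measurable_if) auto
qed

text \<open>The pointwise \<open>lim\<close> along the simple functions is measurable whatever its
  values at points of divergence, and it agrees a.e. with the composition.\<close>

lemma strongly_measurable_compose:
  fixes f :: "real \<Rightarrow> 'a::banach" and y :: "'a \<Rightarrow> real"
  assumes "strongly_measurable f" and y: "continuous_on UNIV y"
  shows "(\<lambda>\<omega>. y (f \<omega>)) \<in> borel_measurable Omega"
proof -
  obtain s where s: "\<And>k. simple_function Omega (s k)"
    "AE \<omega> in Omega. (\<lambda>k::nat. s k \<omega>) \<longlonglongrightarrow> f \<omega>"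
    using assms by (auto simp: strongly_measurable_def)
  have "(\<lambda>\<omega>. y (s k \<omega>)) \<in> borel_measurable Omega" for k
    using simple_function_compose1[OF s(1)] by (rule borel_measurable_simple_function)
  hence "(\<lambda>\<omega>. lim (\<lambda>k. y (s k \<omega>))) \<in> borel_measurable Omega"
    by (rule borel_measurable_lim_metric)
  moreover have "AE \<omega> in Omega. lim (\<lambda>k. y (s k \<omega>)) = y (f \<omega>)"
    using s(2)
  proof eventually_elim
    case (elim \<omega>)
    show ?case by (rule limI) (rule continuous_on_tendsto_compose[OF y elim], auto)
  qed
  ultimately show ?thesis by (rule borel_measurable_Omega_AE)
qed

lemma strongly_measurable_real:
  "strongly_measurable (f :: real \<Rightarrow> real) \<Longrightarrow> f \<in> borel_measurable Omega"
  using strongly_measurable_compose[of f "\<lambda>x. x"] by simp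

lemma strongly_measurable_functional:
  "strongly_measurable f \<Longrightarrow> (\<lambda>\<omega>. blinfun_apply y (f \<omega>)) \<in> borel_measurable Omega"
  for y :: "'a::banach \<Rightarrow>\<^sub>L real"
  by (rule strongly_measurable_compose) (auto intro!: continuous_intros)

section \<open>Weak convergence tested on a finite spanning set of functionals\<close>

lemma weakly_tendsto_if_spanning:
  fixes Y :: "('a::real_normed_vector \<Rightarrow>\<^sub>L real) set" and x' :: "'a \<Rightarrow>\<^sub>L real"
  assumes "span Y = UNIV" and Y: "\<And>y. y \<in> Y \<Longrightarrow> (\<lambda>n. blinfun_apply y (u n)) \<longlonglongrightarrow> blinfun_apply y l"
  shows "(\<lambda>n. blinfun_apply x' (u n)) \<longlonglongrightarrow> blinfun_apply x' l"
proof -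
  have "x' \<in> span Y" using assms(1) by simp
  thus ?thesis
  proof (induction rule: span_induct_alt)
    case base
    show ?case by simp
  next
    case (step c y x')
    thus ?case using Y[of y]
      by (auto simp: blinfun.add_left blinfun.scaleR_left intro!: tendsto_intros)
  qed
qed

lemma finite_dimensional_imp_property_A':
  assumes "finite_dimensional TYPE('a::banach)"
  shows "property_A' TYPE('a) p"
  unfolding property_A'_def
proof (intro allI impI)
  fix f :: "nat \<Rightarrow> real \<Rightarrow> 'a" assume "Lp_bounded p f \<and> scalarly conv_ae f"
  then obtain g where g: "strongly_measurable g"
    "\<And>x' :: 'a \<Rightarrow>\<^sub>L real. AE \<omega> in Omega. (\<lambda>n. blinfun_apply x' (f n \<omega>)) \<longlonglongrightarrow> blinfun_apply x' (g \<omega>)"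
    by (auto simp: scalarly_def conv_ae_def)
  obtain Y :: "('a \<Rightarrow>\<^sub>L real) set" where Y: "finite Y" "span Y = UNIV"
    using finite_dimensional_dual[OF assms] by blast
  have "AE \<omega> in Omega. \<forall>y\<in>Y. (\<lambda>n. blinfun_apply y (f n \<omega>)) \<longlonglongrightarrow> blinfun_apply y (g \<omega>)"
    using Y(1) g(2) by (intro AE_finite_allI) auto
  hence "AE \<omega> in Omega. \<forall>x' :: 'a \<Rightarrow>\<^sub>L real. (\<lambda>n. blinfun_apply x' (f n \<omega>)) \<longlonglongrightarrow> blinfun_apply x' (g \<omega>)"
    by eventually_elim (auto intro: weakly_tendsto_if_spanning[OF Y(2)])
  thus "converges_weakly_ae f" using g(1) unfolding converges_weakly_ae_def by blast
qed

text \<open>Truncation at \<open>1\<close> turns convergence in measure into convergence in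
  \<open>L\<^sub>1\<close>: the integrand is at most \<open>e / 2\<close> off \<open>B n\<close> and
  at most \<open>1\<close> on it.\<close>

lemma conv_in_measure_truncated_integral:
  assumes [measurable]: "\<And>n. u n \<in> borel_measurable Omega" "h \<in> borel_measurable Omega"
    and conv: "conv_in_measure u h"
  shows "(\<lambda>n. \<integral>\<omega>. min 1 \<bar>u n \<omega> - h \<omega>\<bar> \<partial>Omega) \<longlonglongrightarrow> 0"
proof (rule LIMSEQ_I)
  fix e :: real assume "0 < e"
  interpret finite_measure Omega by (rule finite_measure_Omega)
  define B where "B n = {\<omega> \<in> space Omega. \<bar>u n \<omega> - h \<omega>\<bar> > e / 2}" for n
  have [measurable]: "B n \<in> sets Omega" for n unfolding B_def by measurable
  have int: "integrable Omega (\<lambda>\<omega>. min 1 \<bar>u n \<omega> - h \<omega>\<bar>)" for n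
    by (rule integrable_const_bound[of _ 1]) auto
  have le: "(\<integral>\<omega>. min 1 \<bar>u n \<omega> - h \<omega>\<bar> \<partial>Omega) \<le> e / 2 + measure Omega (B n)" for n
  proof -
    have "(\<integral>\<omega>. min 1 \<bar>u n \<omega> - h \<omega>\<bar> \<partial>Omega) \<le> (\<integral>\<omega>. e / 2 + indicator (B n) \<omega> \<partial>Omega)"
    proof (rule integral_mono[OF int])
      show "integrable Omega (\<lambda>\<omega>. e / 2 + indicator (B n) \<omega>)"
        by (intro Bochner_Integration.integrable_add integrable_const integrable_real_indicator)
          (auto simp: less_top[symmetric])
      show "min 1 \<bar>u n \<omega> - h \<omega>\<bar> \<le> e / 2 + indicator (B n) \<omega>" if "\<omega> \<in> space Omega" for \<omega>
        using that \<open>0 < e\<close> by (auto simp: B_def indicator_def min_def)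
    qed
    also have "\<dots> = (\<integral>\<omega>. e / 2 \<partial>Omega) + (\<integral>\<omega>. indicator (B n) \<omega> \<partial>Omega)"
      by (intro Bochner_Integration.integral_add integrable_const integrable_real_indicator)
        (auto simp: less_top[symmetric])
    also have "\<dots> = e / 2 + measure Omega (B n)"
    proof -
      have "B n \<inter> space Omega = B n" by (auto simp: B_def)
      thus ?thesis using measure_Omega_space by (simp del: space_restrict_space space_lebesgue_on)
    qed
    finally show ?thesis .
  qed
  have "(\<lambda>n. measure Omega (B n)) \<longlonglongrightarrow> 0"
    unfolding B_def by (rule conv[unfolded conv_in_measure_def, rule_format]) (use \<open>0 < e\<close> in simp)
  hence "\<forall>\<^sub>F n in sequentially. measure Omega (B n) < e / 2"
    using \<open>0 < e\<close> by (intro order_tendstoD) auto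
  then obtain n0 where n0: "\<And>n. n \<ge> n0 \<Longrightarrow> measure Omega (B n) < e / 2"
    by (auto simp: eventually_sequentially)
  have "0 \<le> (\<integral>\<omega>. min 1 \<bar>u n \<omega> - h \<omega>\<bar> \<partial>Omega)" for n
    by (rule Bochner_Integration.integral_nonneg) auto
  hence "norm ((\<integral>\<omega>. min 1 \<bar>u n \<omega> - h \<omega>\<bar> \<partial>Omega) - 0) < e" if "n \<ge> n0" for n
    using le[of n] n0[OF that] by simp
  thus "\<exists>no. \<forall>n\<ge>no. norm ((\<integral>\<omega>. min 1 \<bar>u n \<omega> - h \<omega>\<bar> \<partial>Omega) - 0) < e" by blast
qed

lemma tendsto_zero_if_truncated_sum:
  fixes d :: "nat \<Rightarrow> 'b \<Rightarrow> real"
  assumes "finite Y" "y \<in> Y" "\<And>n y. 0 \<le> d n y" "(\<lambda>n. \<Sum>y\<in>Y. min 1 (d n y)) \<longlonglongrightarrow> 0"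
  shows "(\<lambda>n. d n y) \<longlonglongrightarrow> 0"
proof (rule order_tendstoI)
  fix e :: real assume "0 < e"
  \<comment> \<open>Below the threshold \<open>min 1 e\<close> the truncation at \<open>1\<close> is
    inactive, so the term itself is below \<open>e\<close>.\<close>
  hence "\<forall>\<^sub>F n in sequentially. (\<Sum>y\<in>Y. min 1 (d n y)) < min 1 e"
    using assms(4) by (intro order_tendstoD) auto
  thus "\<forall>\<^sub>F n in sequentially. d n y < e"
  proof eventually_elim
    case (elim n)
    have "min 1 (d n y) \<le> (\<Sum>y\<in>Y. min 1 (d n y))"
      using assms by (intro member_le_sum) auto
    thus ?case using elim by linarith
  qed
next
  fix e :: real assume "e < 0"
  thus "\<forall>\<^sub>F n in sequentially. e < d n y"
    using less_le_trans[OF _ assms(3)] by (intro always_eventually allI) blast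
qed

text \<open>The truncated deviations for all \<open>y\<close> in \<open>Y\<close> are added into one
  sequence \<open>D\<close> tending to zero in \<open>L\<^sub>1\<close>, so one extraction of an
  a.e. convergent subsequence serves all functionals.\<close>

lemma finite_dimensional_imp_property_B:
  assumes "finite_dimensional TYPE('a::banach)"
  shows "property_B TYPE('a) p"
  unfolding property_B_def
proof (intro allI impI)
  fix f :: "nat \<Rightarrow> real \<Rightarrow> 'a" assume f: "Lp_bounded p f \<and> scalarly conv_in_measure f"
  then obtain g where g: "strongly_measurable g" and conv:
    "\<And>x' :: 'a \<Rightarrow>\<^sub>L real. conv_in_measure (\<lambda>n \<omega>. blinfun_apply x' (f n \<omega>)) (\<lambda>\<omega>. blinfun_apply x' (g \<omega>))"
    by (auto simp: scalarly_def)
  interpret finite_measure Omega by (rule finite_measure_Omega)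
  obtain Y :: "('a \<Rightarrow>\<^sub>L real) set" where Y: "finite Y" "span Y = UNIV"
    using finite_dimensional_dual[OF assms] by blast
  have [measurable]: "(\<lambda>\<omega>. blinfun_apply y (f n \<omega>)) \<in> borel_measurable Omega"
    "(\<lambda>\<omega>. blinfun_apply y (g \<omega>)) \<in> borel_measurable Omega" for n and y :: "'a \<Rightarrow>\<^sub>L real"
    using f g by (auto simp: Lp_bounded_def in_Lp_def intro: strongly_measurable_functional)
  define d where "d n \<omega> y = \<bar>blinfun_apply y (f n \<omega>) - blinfun_apply y (g \<omega>)\<bar>"
    for n \<omega> and y :: "'a \<Rightarrow>\<^sub>L real"
  define D where "D n \<omega> = (\<Sum>y\<in>Y. min 1 (d n \<omega> y))" for n \<omega>
  have int: "integrable Omega (\<lambda>\<omega>. min 1 (d n \<omega> y))" for n y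
    unfolding d_def by (rule integrable_const_bound[of _ 1]) auto
  have "(\<lambda>n. \<integral>\<omega>. norm (D n \<omega>) \<partial>Omega) = (\<lambda>n. \<Sum>y\<in>Y. \<integral>\<omega>. min 1 (d n \<omega> y) \<partial>Omega)"
  proof
    fix n
    have "norm (D n \<omega>) = D n \<omega>" for \<omega> by (simp add: D_def d_def sum_nonneg)
    thus "(\<integral>\<omega>. norm (D n \<omega>) \<partial>Omega) = (\<Sum>y\<in>Y. \<integral>\<omega>. min 1 (d n \<omega> y) \<partial>Omega)"
      using int by (simp add: D_def)
  qed
  moreover have "(\<lambda>n. \<Sum>y\<in>Y. \<integral>\<omega>. min 1 (d n \<omega> y) \<partial>Omega) \<longlonglongrightarrow> (\<Sum>y\<in>Y. 0)"
    unfolding d_def by (intro tendsto_sum conv_in_measure_truncated_integral conv) measurable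
  ultimately have "(\<lambda>n. \<integral>\<omega>. norm (D n \<omega>) \<partial>Omega) \<longlonglongrightarrow> 0" by simp
  moreover have "integrable Omega (D n)" for n
    unfolding D_def using int by (intro Bochner_Integration.integrable_sum) auto
  ultimately obtain r :: "nat \<Rightarrow> nat" where r: "strict_mono r" "AE \<omega> in Omega. (\<lambda>n. D (r n) \<omega>) \<longlonglongrightarrow> 0"
    using tendsto_L1_AE_subseq[of Omega D] by blast
  from r(2) have "AE \<omega> in Omega. \<forall>x' :: 'a \<Rightarrow>\<^sub>L real. (\<lambda>n. blinfun_apply x' (f (r n) \<omega>)) \<longlonglongrightarrow> blinfun_apply x' (g \<omega>)"
  proof eventually_elim
    case (elim \<omega>)
    have "(\<lambda>n. blinfun_apply y (f (r n) \<omega>)) \<longlonglongrightarrow> blinfun_apply y (g \<omega>)" if "y \<in> Y" for y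
    proof -
      have "(\<lambda>n. d (r n) \<omega> y) \<longlonglongrightarrow> 0"
        using elim by (intro tendsto_zero_if_truncated_sum[OF Y(1) that, where d = "\<lambda>n. d (r n) \<omega>"])
          (simp_all add: D_def d_def)
      thus ?thesis unfolding d_def by (simp add: tendsto_rabs_zero_iff LIM_zero_iff)
    qed
    thus ?case by (auto intro: weakly_tendsto_if_spanning[OF Y(2)])
  qed
  hence "converges_weakly_ae (\<lambda>k. f (r k))"
    using g unfolding converges_weakly_ae_def by (intro exI[of _ g] conjI)
  thus "has_weakly_ae_convergent_subseq f"
    using r(1) unfolding has_weakly_ae_convergent_subseq_def by (intro exI[of _ r] conjI)
qed

section \<open>Implications between the modes of convergence and between the properties\<close>

lemma integrable_powr_diff:
  fixes u v :: "'b \<Rightarrow> real"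
  assumes [measurable]: "u \<in> borel_measurable M" "v \<in> borel_measurable M"
    and "integrable M (\<lambda>x. \<bar>u x\<bar> powr p)" "integrable M (\<lambda>x. \<bar>v x\<bar> powr p)" and "0 \<le> p"
  shows "integrable M (\<lambda>x. \<bar>u x - v x\<bar> powr p)"
proof (rule Bochner_Integration.integrable_bound)
  show "integrable M (\<lambda>x. 2 powr p * (\<bar>u x\<bar> powr p + \<bar>v x\<bar> powr p))"
    using assms by simp
  have "\<bar>a - b\<bar> powr p \<le> 2 powr p * (\<bar>a\<bar> powr p + \<bar>b\<bar> powr p)" for a b :: real
  proof -
    have "\<bar>a - b\<bar> powr p \<le> (2 * max \<bar>a\<bar> \<bar>b\<bar>) powr p"
      using \<open>0 \<le> p\<close> by (intro powr_mono2) auto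
    also have "\<dots> = 2 powr p * max \<bar>a\<bar> \<bar>b\<bar> powr p" by (simp add: powr_mult)
    also have "\<dots> \<le> 2 powr p * (\<bar>a\<bar> powr p + \<bar>b\<bar> powr p)"
      by (intro mult_left_mono) (auto simp: max_def)
    finally show ?thesis .
  qed
  thus "AE x in M. norm (\<bar>u x - v x\<bar> powr p) \<le> norm (2 powr p * (\<bar>u x\<bar> powr p + \<bar>v x\<bar> powr p))"
    by (intro AE_I2) (auto simp: abs_mult)
qed measurable

lemma conv_in_Lp_imp_conv_in_measure:
  assumes "1 \<le> p" and conv: "conv_in_Lp p u h"
  shows "conv_in_measure u h"
  unfolding conv_in_measure_def
proof (intro allI impI)
  fix \<epsilon> :: real assume "0 < \<epsilon>"
  interpret finite_measure Omega by (rule finite_measure_Omega)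
  have [measurable]: "u n \<in> borel_measurable Omega" "h \<in> borel_measurable Omega" for n
    using conv by (auto simp: conv_in_Lp_def in_Lp_def intro: strongly_measurable_real)
  define L where "L n = Lp_norm p (\<lambda>\<omega>. u n \<omega> - h \<omega>)" for n
  have L: "L \<longlonglongrightarrow> 0" using conv by (simp add: conv_in_Lp_def L_def[abs_def])
  have le: "measure Omega {\<omega> \<in> space Omega. \<bar>u n \<omega> - h \<omega>\<bar> > \<epsilon>} \<le> L n powr p / \<epsilon> powr p" for n
  proof -
    \<comment> \<open>\<open>conv_in_Lp\<close> asserts integrability for \<open>u n\<close> and
      \<open>h\<close> separately. For the difference it must be derived, since the Bochner integral
      in \<open>Lp_norm\<close> is \<open>0\<close> by default on non-integrable functions.\<close>
    have int: "integrable Omega (\<lambda>\<omega>. \<bar>u n \<omega> - h \<omega>\<bar> powr p)"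
      using conv \<open>1 \<le> p\<close> by (intro integrable_powr_diff) (auto simp: conv_in_Lp_def in_Lp_def)
    have "measure Omega {\<omega> \<in> space Omega. \<bar>u n \<omega> - h \<omega>\<bar> > \<epsilon>}
        \<le> measure Omega {\<omega> \<in> space Omega. \<bar>u n \<omega> - h \<omega>\<bar> powr p \<ge> \<epsilon> powr p}"
    proof (rule finite_measure_mono)
      show "{\<omega> \<in> space Omega. \<bar>u n \<omega> - h \<omega>\<bar> > \<epsilon>}
          \<subseteq> {\<omega> \<in> space Omega. \<bar>u n \<omega> - h \<omega>\<bar> powr p \<ge> \<epsilon> powr p}"
        using \<open>0 < \<epsilon>\<close> \<open>1 \<le> p\<close> by (auto intro!: powr_mono2)
      show "{\<omega> \<in> space Omega. \<bar>u n \<omega> - h \<omega>\<bar> powr p \<ge> \<epsilon> powr p} \<in> sets Omega"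
        by measurable
    qed
    also have "\<dots> \<le> (\<integral>\<omega>. \<bar>u n \<omega> - h \<omega>\<bar> powr p \<partial>Omega) / \<epsilon> powr p"
      using int \<open>0 < \<epsilon>\<close> by (intro integral_Markov_inequality_measure[where A = "space Omega"]) auto
    also have "(\<integral>\<omega>. \<bar>u n \<omega> - h \<omega>\<bar> powr p \<partial>Omega) = L n powr p"
      using \<open>1 \<le> p\<close> by (simp add: L_def Lp_norm_def powr_powr)
    finally show ?thesis .
  qed
  have "0 \<le> L n" for n by (simp add: L_def Lp_norm_def)
  hence lim: "(\<lambda>n. L n powr p / \<epsilon> powr p) \<longlonglongrightarrow> 0"
    using \<open>1 \<le> p\<close> by (intro tendsto_divide_zero tendsto_zero_powrI[OF L tendsto_const]) auto
  show "(\<lambda>n. measure Omega {\<omega> \<in> space Omega. \<bar>u n \<omega> - h \<omega>\<bar> > \<epsilon>}) \<longlonglongrightarrow> 0"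
    by (rule Lim_null_comparison[OF always_eventually lim])
      (intro allI, simp only: real_norm_def abs_of_nonneg[OF measure_nonneg] le)
qed

lemma scalarly_mono:
  assumes "scalarly conv f" "\<And>u h. conv u h \<Longrightarrow> conv' u h"
  shows "scalarly conv' f"
proof -
  obtain g where "strongly_measurable g"
    "\<And>x'. conv (\<lambda>n \<omega>. blinfun_apply x' (f n \<omega>)) (\<lambda>\<omega>. blinfun_apply x' (g \<omega>))"
    using assms(1) by (auto simp: scalarly_def)
  thus ?thesis unfolding scalarly_def using assms(2) by (intro exI[of _ g]) simp
qed

lemma property_B_imp_C:
  assumes "1 \<le> p" "property_B TYPE('a::banach) p"
  shows "property_C TYPE('a) p"
  unfolding property_C_def
proof (intro allI impI, elim conjE)
  fix f :: "nat \<Rightarrow> real \<Rightarrow> 'a"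
  assume f: "Lp_bounded p f" "scalarly (conv_in_Lp p) f"
  have "scalarly conv_in_measure f"
    by (rule scalarly_mono[OF f(2)]) (rule conv_in_Lp_imp_conv_in_measure[OF assms(1)])
  thus "has_weakly_ae_convergent_subseq f" using assms(2) f(1) by (simp add: property_B_def)
qed

lemma property_A'_imp_A:
  assumes "property_A' TYPE('a::banach) p"
  shows "property_A TYPE('a) p"
  unfolding property_A_def has_weakly_ae_convergent_subseq_def
proof (intro allI impI)
  fix f :: "nat \<Rightarrow> real \<Rightarrow> 'a"
  assume "Lp_bounded p f \<and> scalarly conv_ae f"
  hence "converges_weakly_ae f" using assms by (simp add: property_A'_def)
  thus "\<exists>r. strict_mono r \<and> converges_weakly_ae (\<lambda>k. f (r k))"
    by (intro exI[of _ "\<lambda>k. k"]) (simp add: strict_mono_def)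
qed

section \<open>Independence of mixed radix digits\<close>

text \<open>The number of the cell containing \<omega> when \<open>[0, 1)\<close> is cut into
  \<open>\<Prod>k<n. N k\<close> equal half-open intervals.\<close>

definition mixed_radix_index :: "(nat \<Rightarrow> nat) \<Rightarrow> nat \<Rightarrow> real \<Rightarrow> nat" where
  "mixed_radix_index N n \<omega> = nat \<lfloor>\<omega> * (\<Prod>k<n. N k)\<rfloor>"

text \<open>The digits, counted from \<open>0\<close>, of the Cantor series expansion with bases
  \<open>N 0\<close>, \<open>N 1\<close>, and so on.\<close>

definition mixed_radix_digit :: "(nat \<Rightarrow> nat) \<Rightarrow> nat \<Rightarrow> real \<Rightarrow> nat" where
  "mixed_radix_digit N n \<omega> = mixed_radix_index N (Suc n) \<omega> mod N n"

text \<open>Division by \<open>N n\<close> drops the last digit, because the cells of one level are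
  subdivided at the next.\<close>

lemma mixed_radix_index_div:
  assumes "0 < N n" "0 \<le> \<omega>"
  shows "mixed_radix_index N (Suc n) \<omega> div N n = mixed_radix_index N n \<omega>"
proof -
  let ?z = "\<omega> * (\<Prod>k<Suc n. N k)"
  have "\<lfloor>\<omega> * (\<Prod>k<n. N k)\<rfloor> = \<lfloor>?z / real_of_int (int (N n))\<rfloor>"
    using assms(1) by simp
  also have "\<dots> = \<lfloor>?z\<rfloor> div int (N n)"
    by (rule floor_divide_real_eq_div) simp
  finally have eq: "\<lfloor>\<omega> * (\<Prod>k<n. N k)\<rfloor> = \<lfloor>?z\<rfloor> div int (N n)" .
  have "0 \<le> ?z" using assms(2) of_nat_0_le_iff by (rule mult_nonneg_nonneg)
  hence "0 \<le> \<lfloor>?z\<rfloor>" by (simp only: zero_le_floor)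
  thus ?thesis
    by (simp only: mixed_radix_index_def eq nat_div_distrib nat_int)
qed

lemma simple_function_mixed_radix_digit:
  assumes "0 < N n"
  shows "simple_function Omega (mixed_radix_digit N n)"
proof (rule simple_function_borel_measurable)
  have [measurable]: "(\<lambda>\<omega>. \<omega> * c) \<in> borel_measurable Omega" for c :: real
    by (intro measurable_restrict_space1 measurable_completion) measurable
  have "mixed_radix_digit N n \<in> measurable Omega (count_space UNIV)"
    unfolding mixed_radix_digit_def mixed_radix_index_def by measurable
  thus "mixed_radix_digit N n \<in> borel_measurable Omega"
    by (rule measurable_compose) simp
  have "mixed_radix_digit N n ` space Omega \<subseteq> {..<N n}"
    using assms by (auto simp: mixed_radix_digit_def)
  thus "finite (mixed_radix_digit N n ` space Omega)" by (rule finite_subset) simp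
qed

text \<open>At the endpoint \<open>1\<close> the index is one past the last cell, so this point is
  discarded.\<close>

lemma AE_Omega_half_open: "AE \<omega> in Omega. \<omega> \<in> {0..<1}"
proof -
  have "AE \<omega> in lebesgue. \<omega> \<noteq> (1::real)"
    by (rule AE_completion[OF AE_lborel_singleton])
  hence "AE \<omega> in lebesgue. \<omega> \<in> {0..1} \<longrightarrow> \<omega> \<in> {0..<1::real}"
    by eventually_elim auto
  thus ?thesis by (simp add: AE_restrict_space_iff)
qed

lemma measure_mixed_radix_index:
  assumes N: "\<And>k. 0 < N k" and J: "J \<subseteq> {..<(\<Prod>k<n. N k)}"
  shows "{\<omega> \<in> {0..<1}. mixed_radix_index N n \<omega> \<in> J} \<in> sets Omega"
    and "measure Omega {\<omega> \<in> {0..<1}. mixed_radix_index N n \<omega> \<in> J} = real (card J) / real (\<Prod>k<n. N k)"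
proof -
  interpret finite_measure Omega by (rule finite_measure_Omega)
  define m where "m = (\<Prod>k<n. N k)"
  have m: "0 < m" unfolding m_def using N by (intro prod_pos) simp
  define A where "A j = {real j / m..<(real j + 1) / m}" for j :: nat
  have cell: "real j \<le> \<omega> * m" "\<omega> * m < real j + 1" "0 \<le> \<omega>" "\<omega> < 1"
    if "j \<in> J" "\<omega> \<in> A j" for j \<omega>
  proof -
    have "j < m" using that(1) J by (auto simp: m_def)
    hence "real j + 1 \<le> m" by simp
    moreover show *: "real j \<le> \<omega> * m" "\<omega> * m < real j + 1"
      using that(2) m by (auto simp: A_def field_simps)
    ultimately have "\<omega> * m < 1 * real m" by linarith
    thus "\<omega> < 1" by (rule mult_right_less_imp_less) simp
    have "0 \<le> \<omega> * m" using *(1) by linarith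
    thus "0 \<le> \<omega>" using m by (simp add: zero_le_mult_iff)
  qed
  have eq: "{\<omega> \<in> {0..<1}. mixed_radix_index N n \<omega> \<in> J} = (\<Union>j\<in>J. A j)"
  proof (intro equalityI subsetI)
    fix \<omega> assume \<omega>: "\<omega> \<in> {\<omega> \<in> {0..<1}. mixed_radix_index N n \<omega> \<in> J}"
    hence "0 \<le> \<omega> * m" by simp
    hence "real (mixed_radix_index N n \<omega>) = real_of_int \<lfloor>\<omega> * m\<rfloor>"
      unfolding mixed_radix_index_def m_def by (simp only: of_nat_nat zero_le_floor)
    hence "real (mixed_radix_index N n \<omega>) \<le> \<omega> * m" "\<omega> * m < real (mixed_radix_index N n \<omega>) + 1"
      by linarith+
    hence "\<omega> \<in> A (mixed_radix_index N n \<omega>)"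
      using m by (simp add: A_def field_simps)
    thus "\<omega> \<in> (\<Union>j\<in>J. A j)" using \<omega> by blast
  next
    fix \<omega> assume "\<omega> \<in> (\<Union>j\<in>J. A j)"
    then obtain j where j: "j \<in> J" "\<omega> \<in> A j" by blast
    have "\<lfloor>\<omega> * m\<rfloor> = int j" using cell[OF j] by linarith
    hence "mixed_radix_index N n \<omega> = j"
      unfolding mixed_radix_index_def m_def[symmetric] by simp
    thus "\<omega> \<in> {\<omega> \<in> {0..<1}. mixed_radix_index N n \<omega> \<in> J}" using j(1) cell[OF j] by simp
  qed
  have fin: "finite J" using J by (rule finite_subset) simp
  have A01: "A j \<subseteq> {0..1}" if "j \<in> J" for j
    using cell(3)[OF that] less_imp_le[OF cell(4)[OF that]] by auto
  have A: "A j \<in> sets Omega" "measure Omega (A j) = 1 / m" if "j \<in> J" for j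
  proof -
    show "A j \<in> sets Omega" using A01[OF that] by (simp add: sets_restrict_space_iff A_def)
    have "measure Omega (A j) = measure lebesgue (A j)"
      using A01[OF that] by (intro measure_restrict_space) auto
    also have "\<dots> = 1 / m" using m by (simp add: A_def field_simps)
    finally show "measure Omega (A j) = 1 / m" .
  qed
  show "{\<omega> \<in> {0..<1}. mixed_radix_index N n \<omega> \<in> J} \<in> sets Omega"
    unfolding eq using A(1) fin by (intro sets.finite_UN) auto
  have "disjoint_family_on A J"
    unfolding disjoint_family_on_def
  proof (intro ballI impI)
    fix i j assume "i \<in> J" "j \<in> J" "i \<noteq> j"
    have False if "\<omega> \<in> A i" "\<omega> \<in> A j" for \<omega>
    proof -
      have "real i < real j + 1" "real j < real i + 1"
        using that m by (auto simp: A_def field_simps)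
      thus False using \<open>i \<noteq> j\<close> by linarith
    qed
    thus "A i \<inter> A j = {}" by blast
  qed
  hence "measure Omega (\<Union>j\<in>J. A j) = (\<Sum>j\<in>J. measure Omega (A j))"
    using fin A(1) by (intro finite_measure_finite_Union) auto
  also have "\<dots> = card J / m" using A(2) by simp
  finally show "measure Omega {\<omega> \<in> {0..<1}. mixed_radix_index N n \<omega> \<in> J} = real (card J) / real (\<Prod>k<n. N k)"
    unfolding eq by (simp add: m_def)
qed

text \<open>Index and initial digits determine each other by division with remainder, so a condition
  on digits selects a set of cells whose cardinality is a product. For \<open>n = 0\<close> there is
  the single cell \<open>0\<close>.\<close>

lemma mixed_radix_cylinder:
  assumes N: "\<And>k. 0 < N k" and H: "\<And>k. H k \<subseteq> {..<N k}"
  shows "\<exists>J\<subseteq>{..<(\<Prod>k<n. N k)}. card J = (\<Prod>k<n. card (H k)) \<and>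
    {\<omega> \<in> {0..<1}. \<forall>k<n. mixed_radix_digit N k \<omega> \<in> H k} = {\<omega> \<in> {0..<1}. mixed_radix_index N n \<omega> \<in> J}"
proof (induction n)
  case 0
  show ?case
    by (rule exI[of _ "{0}"]) (auto simp: mixed_radix_index_def floor_eq_iff)
next
  case (Suc n)
  then obtain J where J: "J \<subseteq> {..<(\<Prod>k<n. N k)}" "card J = (\<Prod>k<n. card (H k))"
    "\<And>\<omega>. \<omega> \<in> {0..<1} \<Longrightarrow> (\<forall>k<n. mixed_radix_digit N k \<omega> \<in> H k) \<longleftrightarrow> mixed_radix_index N n \<omega> \<in> J"
    by blast
  define J' where "J' = (\<lambda>(i, l). i * N n + l) ` (J \<times> H n)"
  have mem: "j \<in> J' \<longleftrightarrow> j div N n \<in> J \<and> j mod N n \<in> H n" for j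
  proof
    assume "j \<in> J'"
    then obtain i l where il: "i \<in> J" "l \<in> H n" "j = i * N n + l" by (auto simp: J'_def)
    moreover have "l < N n" using il(2) H by auto
    ultimately show "j div N n \<in> J \<and> j mod N n \<in> H n" using N[of n] by simp
  next
    assume "j div N n \<in> J \<and> j mod N n \<in> H n"
    thus "j \<in> J'" unfolding J'_def by (intro image_eqI[of _ _ "(j div N n, j mod N n)"]) auto
  qed
  have "inj_on (\<lambda>(i, l). i * N n + l) (J \<times> H n)"
  proof (rule inj_on_inverseI[where g = "\<lambda>j. (j div N n, j mod N n)"])
    fix z assume "z \<in> J \<times> H n"
    moreover have "snd z < N n" using calculation H[of n] by auto
    ultimately show "((case z of (i, l) \<Rightarrow> i * N n + l) div N n, (case z of (i, l) \<Rightarrow> i * N n + l) mod N n) = z"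
      using N[of n] by (cases z) auto
  qed
  hence "card J' = (\<Prod>k<Suc n. card (H k))"
    by (simp add: J'_def card_image card_cartesian_product J(2))
  moreover have "J' \<subseteq> {..<(\<Prod>k<Suc n. N k)}"
  proof
    fix j assume "j \<in> J'"
    hence "j div N n < (\<Prod>k<n. N k)" using J(1) by (auto simp: mem)
    thus "j \<in> {..<(\<Prod>k<Suc n. N k)}" using N[of n] by (simp add: div_less_iff_less_mult)
  qed
  moreover have "(\<forall>k<Suc n. mixed_radix_digit N k \<omega> \<in> H k) \<longleftrightarrow> mixed_radix_index N (Suc n) \<omega> \<in> J'"
    if "\<omega> \<in> {0..<1}" for \<omega>
    using J(3)[OF that] mixed_radix_index_div[of N n \<omega>, OF N] that
    by (auto simp: mem less_Suc_eq mixed_radix_digit_def)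
  ultimately show ?case by blast
qed

theorem mixed_radix_digits_independent:
  assumes N: "\<And>k. 0 < N k" and H: "\<And>k. H k \<subseteq> {..<N k}"
  shows "{\<omega> \<in> {0..<1}. \<forall>k<n. mixed_radix_digit N k \<omega> \<in> H k} \<in> sets Omega"
    and "measure Omega {\<omega> \<in> {0..<1}. \<forall>k<n. mixed_radix_digit N k \<omega> \<in> H k} = (\<Prod>k<n. card (H k) / N k)"
proof -
  obtain J where "J \<subseteq> {..<(\<Prod>k<n. N k)} \<and> card J = (\<Prod>k<n. card (H k)) \<and>
    {\<omega> \<in> {0..<1}. \<forall>k<n. mixed_radix_digit N k \<omega> \<in> H k} = {\<omega> \<in> {0..<1}. mixed_radix_index N n \<omega> \<in> J}"
    using mixed_radix_cylinder[OF assms] by (rule exE)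
  note J = this[THEN conjunct1] this[THEN conjunct2, THEN conjunct1] this[THEN conjunct2, THEN conjunct2]
  show "{\<omega> \<in> {0..<1}. \<forall>k<n. mixed_radix_digit N k \<omega> \<in> H k} \<in> sets Omega"
    unfolding J(3) by (rule measure_mixed_radix_index[OF N J(1)])
  have eq: "real (card J) / real (\<Prod>k<n. N k) = (\<Prod>k<n. card (H k) / N k)"
    by (simp add: J(2) prod_dividef)
  show "measure Omega {\<omega> \<in> {0..<1}. \<forall>k<n. mixed_radix_digit N k \<omega> \<in> H k} = (\<Prod>k<n. card (H k) / N k)"
    unfolding J(3) measure_mixed_radix_index(2)[OF N J(1)] using eq by simp
qed

text \<open>Each digit is uniformly distributed, so integrals of functions of one digit become
  finite averages; all norms of the counterexample are computed in this way.\<close>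

lemma integral_mixed_radix_digit:
  fixes G :: "nat \<Rightarrow> real"
  assumes N: "\<And>k. 0 < N k"
  shows "integrable Omega (\<lambda>\<omega>. G (mixed_radix_digit N n \<omega>))"
    and "(\<integral>\<omega>. G (mixed_radix_digit N n \<omega>) \<partial>Omega) = (\<Sum>l<N n. G l) / N n"
proof -
  interpret finite_measure Omega by (rule finite_measure_Omega)
  define D where "D l = {\<omega> \<in> space Omega. mixed_radix_digit N n \<omega> = l}" for l
  have sf: "simple_function Omega (mixed_radix_digit N n)"
    by (rule simple_function_mixed_radix_digit) (rule N)
  have [measurable]: "D l \<in> sets Omega" for l
  proof -
    have "D l = mixed_radix_digit N n -` {l} \<inter> space Omega" by (auto simp: D_def)
    thus ?thesis using simple_functionD(2)[OF sf, of "{l}"] by simp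
  qed
  have prob: "measure Omega (D l) = 1 / N n" if "l < N n" for l
  proof -
    \<comment> \<open>Only digit \<open>n\<close> is constrained; the other factors of the cylinder
      measure are \<open>1\<close>.\<close>
    define H where "H k = (if k = n then {l} else {..<N k})" for k
    have H: "H k \<subseteq> {..<N k}" for k using that by (auto simp: H_def)
    have "measure Omega (D l) = measure Omega {\<omega> \<in> {0..<1}. \<forall>k<Suc n. mixed_radix_digit N k \<omega> \<in> H k}"
    proof (rule finite_measure_eq_AE)
      show "AE \<omega> in Omega. \<omega> \<in> D l \<longleftrightarrow> \<omega> \<in> {\<omega> \<in> {0..<1}. \<forall>k<Suc n. mixed_radix_digit N k \<omega> \<in> H k}"
        using AE_Omega_half_open
        by eventually_elim (use N in \<open>auto simp: D_def H_def mixed_radix_digit_def\<close>)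
    qed (use mixed_radix_digits_independent(1)[OF N H] in simp_all)
    also have "\<dots> = (\<Prod>k<Suc n. card (H k) / N k)"
      by (rule mixed_radix_digits_independent(2)[OF N H])
    also have "\<dots> = 1 / N n"
      using N by (simp add: H_def prod.neutral)
    finally show ?thesis .
  qed
  have eq: "G (mixed_radix_digit N n \<omega>) = (\<Sum>l<N n. G l * indicator (D l) \<omega>)" if "\<omega> \<in> space Omega" for \<omega>
  proof -
    have "mixed_radix_digit N n \<omega> < N n" using N by (simp add: mixed_radix_digit_def)
    moreover have "indicator (D l) \<omega> = (if mixed_radix_digit N n \<omega> = l then 1 else 0 :: real)" for l
      using that by (auto simp: D_def indicator_def)
    moreover from this have "(\<Sum>l<N n. G l * indicator (D l) \<omega>)
        = (\<Sum>l<N n. if mixed_radix_digit N n \<omega> = l then G l else 0)"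
      by (intro sum.cong) simp_all
    ultimately show ?thesis by simp
  qed
  have int: "integrable Omega (\<lambda>\<omega>. G l * indicator (D l) \<omega>)" for l
    by (intro integrable_mult_right integrable_real_indicator) (auto simp: less_top[symmetric])
  have "integrable Omega (\<lambda>\<omega>. \<Sum>l<N n. G l * indicator (D l) \<omega>)"
    using int by (intro Bochner_Integration.integrable_sum) auto
  thus "integrable Omega (\<lambda>\<omega>. G (mixed_radix_digit N n \<omega>))"
    by (subst Bochner_Integration.integrable_cong[OF refl eq])
  have "(\<integral>\<omega>. G (mixed_radix_digit N n \<omega>) \<partial>Omega) = (\<integral>\<omega>. (\<Sum>l<N n. G l * indicator (D l) \<omega>) \<partial>Omega)"
    by (rule Bochner_Integration.integral_cong[OF refl eq])
  also have "\<dots> = (\<Sum>l<N n. \<integral>\<omega>. G l * indicator (D l) \<omega> \<partial>Omega)"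
    using int by (intro Bochner_Integration.integral_sum) auto
  also have "\<dots> = (\<Sum>l<N n. G l * (1 / N n))"
  proof (rule sum.cong[OF refl])
    fix l assume "l \<in> {..<N n}"
    moreover have "D l \<inter> space Omega = D l" by (auto simp: D_def)
    ultimately show "(\<integral>\<omega>. G l * indicator (D l) \<omega> \<partial>Omega) = G l * (1 / N n)"
      using prob[of l] by (simp del: space_restrict_space space_lebesgue_on)
  qed
  also have "\<dots> = (\<Sum>l<N n. G l) / N n" by (simp add: sum_divide_distrib)
  finally show "(\<integral>\<omega>. G (mixed_radix_digit N n \<omega>) \<partial>Omega) = (\<Sum>l<N n. G l) / N n" .
qed

text \<open>A second Borel-Cantelli argument: selecting \<open>K\<close> of the infinitely many
  indices in question and bounding the other factors by \<open>1\<close>, the set where no digit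
  leaves has measure at most \<open>(1 - q) ^ K\<close>, for every \<open>K\<close>.\<close>

lemma mixed_radix_digits_AE_leave:
  fixes q :: real
  assumes N: "\<And>k. 0 < N k" and H: "\<And>k. H k \<subseteq> {..<N k}"
    and "0 < q" and inf: "infinite {k. card (H k) \<le> (1 - q) * N k}"
  shows "AE \<omega> in Omega. \<exists>k. mixed_radix_digit N k \<omega> \<notin> H k"
proof -
  interpret finite_measure Omega by (rule finite_measure_Omega)
  define S where "S n = {\<omega> \<in> {0..<1}. \<forall>k<n. mixed_radix_digit N k \<omega> \<in> H k}" for n
  let ?I = "{k. card (H k) \<le> (1 - q) * N k}"
  have S: "S n \<in> sets Omega" "measure Omega (S n) = (\<Prod>k<n. card (H k) / N k)" for n
    unfolding S_def using mixed_radix_digits_independent[OF N H] by auto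
  have frac: "0 \<le> card (H k) / N k" "card (H k) / N k \<le> 1" for k
    using card_mono[OF _ H, of k] N[of k] by (auto simp: field_simps)
  have small: "card (H k) / N k \<le> 1 - q" if "k \<in> ?I" for k
    using that N[of k] by (simp add: field_simps)
  have "q \<le> 1"
  proof -
    obtain k where "k \<in> ?I" using inf infinite_imp_nonempty by blast
    thus ?thesis using small[of k] frac(1)[of k] by linarith
  qed
  have null: "measure Omega (\<Inter>n. S n) \<le> (1 - q) ^ K" for K
  proof -
    obtain I where I: "I \<subseteq> ?I" "finite I" "card I = K"
      using infinite_arbitrarily_large[OF inf] by blast
    obtain n where n: "I \<subseteq> {..<n}" using finite_nat_bounded[OF I(2)] by blast
    have "measure Omega (\<Inter>n. S n) \<le> measure Omega (S n)"
      using S(1) by (intro finite_measure_mono) auto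
    also have "\<dots> = (\<Prod>k<n. card (H k) / N k)" by (rule S(2))
    also have "\<dots> = (\<Prod>k\<in>I. card (H k) / N k) * (\<Prod>k\<in>{..<n} - I. card (H k) / N k)"
      using prod.subset_diff[OF n] by (simp add: mult.commute)
    also have "\<dots> \<le> (\<Prod>k\<in>I. card (H k) / N k) * 1"
      using frac by (intro mult_left_mono prod_le_1 prod_nonneg) auto
    also have "\<dots> \<le> (\<Prod>k\<in>I. 1 - q)"
      using frac small I(1) unfolding mult_1_right by (intro prod_mono) auto
    also have "\<dots> = (1 - q) ^ K" by (simp add: I(3))
    finally show ?thesis .
  qed
  have "(\<lambda>K. (1 - q) ^ K) \<longlonglongrightarrow> 0"
    using \<open>0 < q\<close> \<open>q \<le> 1\<close> by (intro LIMSEQ_realpow_zero) auto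
  hence "measure Omega (\<Inter>n. S n) \<le> 0"
    by (rule LIMSEQ_le_const) (use null in blast)
  hence "measure Omega (\<Inter>n. S n) = 0" using measure_nonneg[of Omega "\<Inter>n. S n"] by linarith
  moreover have meas: "(\<Inter>n. S n) \<in> sets Omega" using S(1) by (intro sets.countable_INT) auto
  ultimately have "(\<Inter>n. S n) \<in> null_sets Omega"
    by (simp add: null_sets_def emeasure_eq_measure)
  hence "AE \<omega> in Omega. \<omega> \<notin> (\<Inter>n. S n)" by (rule AE_not_in)
  with AE_Omega_half_open show ?thesis
    by eventually_elim (auto simp: S_def)
qed

section \<open>Infinite-dimensional spaces\<close>

text \<open>A digit below \<open>M * T\<close> encodes a pair, with quotient \<open>a\<close> and
  remainder \<open>b\<close>.\<close>

lemma sum_div_mod: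
  fixes f :: "nat \<Rightarrow> nat \<Rightarrow> real"
  assumes "0 < T"
  shows "(\<Sum>l<M * T. f (l div T) (l mod T)) = (\<Sum>a<M. \<Sum>b<T. f a b)"
proof -
  have "(\<Sum>l<M * T. f (l div T) (l mod T)) = (\<Sum>a<M. \<Sum>l\<in>{a * T..<a * T + T}. f (l div T) (l mod T))"
    by (rule sum.nat_group[symmetric])
  also have "\<dots> = (\<Sum>a<M. \<Sum>b<T. f a b)"
  proof (rule sum.cong[OF refl])
    fix a
    have "(\<Sum>l\<in>{a * T..<a * T + T}. f (l div T) (l mod T))
        = (\<Sum>b\<in>{0..<T}. f ((b + a * T) div T) ((b + a * T) mod T))"
      using sum.shift_bounds_nat_ivl[of "\<lambda>l. f (l div T) (l mod T)" 0 "a * T" T]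
      by (simp only: add_0 add.commute[of T])
    also have "\<dots> = (\<Sum>b<T. f a b)"
      using assms by (intro sum.cong) auto
    finally show "(\<Sum>l\<in>{a * T..<a * T + T}. f (l div T) (l mod T)) = (\<Sum>b<T. f a b)" .
  qed
  finally show ?thesis .
qed

lemma sum_inverse_sqrt_le: "(\<Sum>a<M. 1 / sqrt (real a + 1)) \<le> 2 * sqrt M"
proof (induction M)
  case (Suc M)
  define a b where "a = sqrt (real M)" and "b = sqrt (real M + 1)"
  have b: "0 < b" "b * b = a * a + 1" by (simp_all add: a_def b_def)
  have "0 \<le> (b - a) * (b - a)" by simp
  \<comment> \<open>Telescoping form of the comparison with an integral: the new term is at most
    twice the increment of the square root.\<close>
  hence "1 \<le> 2 * (b - a) * b" using b(2) by (simp add: algebra_simps)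
  hence "1 / b \<le> 2 * (b - a)" using b(1) by (simp add: field_simps)
  moreover have "(\<Sum>a<M. 1 / sqrt (real a + 1)) \<le> 2 * a" using Suc by (simp add: a_def)
  ultimately have "(\<Sum>a<M. 1 / sqrt (real a + 1)) + 1 / b \<le> 2 * b" by simp
  thus ?case by (simp add: b_def add.commute)
qed simp

text \<open>The mean over \<open>a\<close> stays bounded by \<open>2\<close> for all
  \<open>M\<close>, although for fixed \<open>K\<close> the proportion of \<open>a\<close> with
  \<open>M / (a + 1) \<ge> K\<close> does not vanish as \<open>M\<close> grows.\<close>

lemma sum_sqrt_ratio_le: "(\<Sum>a<M. sqrt (real M / (real a + 1))) \<le> 2 * real M"
proof -
  have "(\<Sum>a<M. sqrt (real M / (real a + 1))) = sqrt M * (\<Sum>a<M. 1 / sqrt (real a + 1))"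
    by (simp add: real_sqrt_divide sum_distrib_left)
  also have "\<dots> \<le> sqrt M * (2 * sqrt M)"
    by (intro mult_left_mono sum_inverse_sqrt_le) simp
  also have "\<dots> = 2 * real M" by (simp add: mult.left_commute[of "sqrt M"])
  finally show ?thesis .
qed

lemma simple_function_imp_strongly_measurable:
  "simple_function Omega f \<Longrightarrow> strongly_measurable f"
  unfolding strongly_measurable_def by (intro exI[of _ "\<lambda>_. f"]) simp

text \<open>By monotone convergence the sum of the functions has a finite integral, so it is finite
  a.e. and its terms tend to zero.\<close>

lemma AE_tendsto_zero_if_summable_integrals:
  fixes u :: "nat \<Rightarrow> 'b \<Rightarrow> real"
  assumes int: "\<And>n. integrable M (u n)" and nonneg: "\<And>n x. 0 \<le> u n x"
    and sum: "summable (\<lambda>n. \<integral>x. u n x \<partial>M)"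
  shows "AE x in M. (\<lambda>n. u n x) \<longlonglongrightarrow> 0"
proof -
  have [measurable]: "u n \<in> borel_measurable M" for n
    using int by (rule borel_measurable_integrable)
  have "(\<integral>\<^sup>+x. (\<Sum>n. ennreal (u n x)) \<partial>M) = (\<Sum>n. \<integral>\<^sup>+x. ennreal (u n x) \<partial>M)"
    by (intro nn_integral_suminf) measurable
  also have "\<dots> = (\<Sum>n. ennreal (\<integral>x. u n x \<partial>M))"
    using int nonneg by (simp add: nn_integral_eq_integral)
  also have "\<dots> \<noteq> \<infinity>"
    unfolding infinity_ennreal_def by (rule ennreal_suminf_neq_top[OF sum]) (simp add: nonneg)
  finally have "AE x in M. (\<Sum>n. ennreal (u n x)) \<noteq> \<infinity>"
    by (intro nn_integral_PInf_AE) measurable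
  thus ?thesis
  proof eventually_elim
    case (elim x)
    hence "summable (\<lambda>n. u n x)" using nonneg by (intro summable_suminf_not_top) auto
    thus ?case by (rule summable_LIMSEQ_zero)
  qed
qed

lemma AE_Omega_not_False: "\<not> (AE \<omega> in Omega. False)"
proof
  interpret finite_measure Omega by (rule finite_measure_Omega)
  assume "AE \<omega> in Omega. False"
  hence "measure Omega (space Omega) = measure Omega {}"
    by (intro finite_measure_eq_AE) (auto elim: eventually_mono)
  thus False using measure_Omega_space by (simp del: space_restrict_space space_lebesgue_on)
qed

text \<open>The values are \<open>c\<^sub>a x\<^sub>b\<close> with the pair \<open>(a, b)\<close> uniformly distributed: the heavy tail of
  \<open>(c\<^sub>a)\<^sup>p = sqrt ((n + 1) / (a + 1))\<close> makes every subsequence of the independent norms unbounded,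
  while the spread-out directions \<open>x\<^sub>b\<close> make every functional small.\<close>

theorem scalarly_null_sequence_without_weak_limit:
  assumes inf: "\<not> finite_dimensional TYPE('a::banach)" and p: "1 \<le> p"
  shows "\<exists>f :: nat \<Rightarrow> real \<Rightarrow> 'a. Lp_bounded p f \<and> scalarly conv_ae f \<and>
    scalarly (conv_in_Lp p) f \<and> \<not> has_weakly_ae_convergent_subseq f"
proof -
  interpret finite_measure Omega by (rule finite_measure_Omega)
  \<comment> \<open>Geometric decay of the tolerance makes the scalar integrals summable, as a.e.
    convergence of the whole sequence requires.\<close>
  have "\<forall>n. \<exists>T>0. \<exists>x :: nat \<Rightarrow> 'a. (\<forall>t<T. norm (x t) = 1) \<and>
    (\<forall>g :: 'a \<Rightarrow>\<^sub>L real. (\<Sum>t<T. \<bar>blinfun_apply g (x t)\<bar>) \<le> (1 / 2) ^ n * T * norm g)"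
    by (intro allI unit_vectors_scalarly_small[OF inf]) simp
  then obtain T and x :: "nat \<Rightarrow> nat \<Rightarrow> 'a" where T: "\<And>n. 0 < T n"
    and x: "\<And>n t. t < T n \<Longrightarrow> norm (x n t) = 1"
    and small: "\<And>n (g :: 'a \<Rightarrow>\<^sub>L real). (\<Sum>t<T n. \<bar>blinfun_apply g (x n t)\<bar>) \<le> (1 / 2) ^ n * T n * norm g"
    by metis
  \<comment> \<open>Digit \<open>n\<close> encodes a pair: its quotient by \<open>T n\<close>
    selects one of \<open>Suc n\<close> norms, its remainder one of \<open>T n\<close>
    directions.\<close>
  define N where "N n = Suc n * T n" for n
  have N: "0 < N n" for n using T by (simp add: N_def)
  have N_ratio: "real (Suc n) * real (T n) / real (N n) = 1" for n
    using T[of n] unfolding N_def of_nat_mult by (simp del: of_nat_Suc)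
  define s where "s n a = sqrt (real (Suc n) / (real a + 1))" for n a
  have s0: "0 \<le> s n a" for n a by (simp add: s_def)
  have s_sum: "(\<Sum>a<Suc n. s n a) \<le> 2 * real (Suc n)" for n
    unfolding s_def by (rule sum_sqrt_ratio_le)
  define F where "F n l = s n (l div T n) powr (1 / p) *\<^sub>R x n (l mod T n)" for n l
  define f where "f n \<omega> = F n (mixed_radix_digit N n \<omega>)" for n \<omega>
  have x': "norm (x n (l mod T n)) = 1" for n l using T by (intro x) simp
  have norm_F: "norm (F n l) powr p = s n (l div T n)" for n l
    using p s0[of n "l div T n"] by (simp add: F_def x' powr_powr)
  have fun_F: "\<bar>blinfun_apply g (F n l)\<bar> powr p = s n (l div T n) * \<bar>blinfun_apply g (x n (l mod T n))\<bar> powr p"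
    for g :: "'a \<Rightarrow>\<^sub>L real" and n l
    using p s0[of n "l div T n"] by (simp add: F_def blinfun.scaleR_right abs_mult powr_mult powr_powr)
  \<comment> \<open>Quotient and remainder vary independently, so the sum splits into a factor for
    norms and one for directions.\<close>
  have sum_F: "(\<Sum>l<N n. s n (l div T n) * \<psi> (l mod T n)) = (\<Sum>a<Suc n. s n a) * (\<Sum>b<T n. \<psi> b)"
    for n and \<psi> :: "nat \<Rightarrow> real"
    unfolding N_def using sum_div_mod[OF T, of "\<lambda>a b. s n a * \<psi> b" n "Suc n"]
    by (simp only: sum_product)
  have simple: "simple_function Omega (\<lambda>\<omega>. G (mixed_radix_digit N n \<omega>))" for n and G :: "nat \<Rightarrow> 'c"
    by (rule simple_function_compose1[OF simple_function_mixed_radix_digit]) (rule N)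

  have "in_Lp p (f n)" for n
    unfolding in_Lp_def f_def
    using simple integral_mixed_radix_digit(1)[of N "\<lambda>l. norm (F n l) powr p", OF N]
    by (auto intro: simple_function_imp_strongly_measurable)
  moreover have "Lp_norm p (f n) \<le> 2 powr (1 / p)" for n
  proof -
    have "(\<integral>\<omega>. norm (f n \<omega>) powr p \<partial>Omega) = (\<Sum>l<N n. norm (F n l) powr p) / N n"
      unfolding f_def by (rule integral_mixed_radix_digit(2)[OF N])
    also have "\<dots> = (\<Sum>a<Suc n. s n a) * T n / N n"
      using sum_F[of n "\<lambda>_. 1"] by (simp add: norm_F)
    also have "\<dots> \<le> (2 * real (Suc n)) * T n / N n"
      using s_sum by (intro divide_right_mono mult_right_mono) auto
    also have "\<dots> = 2 * (real (Suc n) * real (T n) / real (N n))" by (simp only: mult.assoc times_divide_eq_right)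
    also have "\<dots> = 2" by (simp only: N_ratio)
    finally show ?thesis unfolding Lp_norm_def using p by (intro powr_mono2) auto
  qed
  ultimately have bounded: "Lp_bounded p f"
    unfolding Lp_bounded_def by (auto intro!: bdd_aboveI2)

  define I where "I g n = (\<integral>\<omega>. \<bar>blinfun_apply g (f n \<omega>)\<bar> powr p \<partial>Omega)" for g :: "'a \<Rightarrow>\<^sub>L real" and n
  have int: "integrable Omega (\<lambda>\<omega>. \<bar>blinfun_apply g (f n \<omega>)\<bar> powr p)" for g :: "'a \<Rightarrow>\<^sub>L real" and n
    unfolding f_def by (rule integral_mixed_radix_digit(1)[OF N])
  have I0: "0 \<le> I g n" for g n by (simp add: I_def)
  \<comment> \<open>The bound \<open>\<bar>g x\<bar> \<le> norm g\<close> on unit vectors reduces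
    \<open>p\<close>-th powers to first powers, for which \<open>small\<close> applies; averaging
    the norms contributes the factor \<open>2\<close>.\<close>
  have I: "I g n \<le> 2 * norm g powr (p - 1) * norm g * (1 / 2) ^ n" for g n
  proof -
    let ?K = "norm g"
    have "\<bar>blinfun_apply g (x n b)\<bar> powr p \<le> ?K powr (p - 1) * \<bar>blinfun_apply g (x n b)\<bar>" if "b < T n" for b
    proof -
      let ?z = "\<bar>blinfun_apply g (x n b)\<bar>"
      have z: "?z \<le> ?K" using norm_blinfun[of g "x n b"] x[OF that] by simp
      have "?z powr p = ?z powr (p - 1) * ?z" using powr_add[of ?z "p - 1" 1] by simp
      also have "\<dots> \<le> ?K powr (p - 1) * ?z" using z p by (intro mult_right_mono powr_mono2) auto
      finally show ?thesis .
    qed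
    hence "(\<Sum>b<T n. \<bar>blinfun_apply g (x n b)\<bar> powr p) \<le> ?K powr (p - 1) * (\<Sum>b<T n. \<bar>blinfun_apply g (x n b)\<bar>)"
      unfolding sum_distrib_left by (intro sum_mono) simp
    also have "\<dots> \<le> ?K powr (p - 1) * ((1 / 2) ^ n * T n * ?K)"
      by (intro mult_left_mono small) simp
    finally have *: "(\<Sum>b<T n. \<bar>blinfun_apply g (x n b)\<bar> powr p) \<le> ?K powr (p - 1) * ((1 / 2) ^ n * T n * ?K)" .
    have "I g n = (\<Sum>l<N n. \<bar>blinfun_apply g (F n l)\<bar> powr p) / N n"
      unfolding I_def f_def by (rule integral_mixed_radix_digit(2)[OF N])
    also have "\<dots> = (\<Sum>a<Suc n. s n a) * (\<Sum>b<T n. \<bar>blinfun_apply g (x n b)\<bar> powr p) / N n"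
      by (simp only: fun_F sum_F[of n "\<lambda>b. \<bar>blinfun_apply g (x n b)\<bar> powr p"])
    also have "\<dots> \<le> (2 * real (Suc n)) * (?K powr (p - 1) * ((1 / 2) ^ n * T n * ?K)) / N n"
      by (intro divide_right_mono mult_mono s_sum * sum_nonneg) (auto simp: s0)
    also have "\<dots> = 2 * ?K powr (p - 1) * ?K * (1 / 2) ^ n * (real (Suc n) * real (T n) / real (N n))"
      by (simp only: times_divide_eq_right mult_ac)
    also have "\<dots> = 2 * ?K powr (p - 1) * ?K * (1 / 2) ^ n" by (simp only: N_ratio mult_1_right)
    finally show ?thesis .
  qed
  have summ: "summable (\<lambda>n. 2 * norm g powr (p - 1) * norm g * (1 / 2) ^ n)" for g :: "'a \<Rightarrow>\<^sub>L real"
    by (intro summable_mult summable_geometric) simp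
  have summ_I: "summable (I g)" for g
    using I I0 by (intro summable_comparison_test'[OF summ[of g], where N = 0]) simp

  have "strongly_measurable (\<lambda>_. 0 :: 'a)"
    by (rule simple_function_imp_strongly_measurable) simp
  moreover have "conv_ae (\<lambda>n \<omega>. blinfun_apply g (f n \<omega>)) (\<lambda>\<omega>. blinfun_apply g 0)" for g
  proof -
    have "AE \<omega> in Omega. (\<lambda>n. \<bar>blinfun_apply g (f n \<omega>)\<bar> powr p) \<longlonglongrightarrow> 0"
      using summ_I[of g] unfolding I_def[abs_def]
      by (intro AE_tendsto_zero_if_summable_integrals int) auto
    hence "AE \<omega> in Omega. (\<lambda>n. blinfun_apply g (f n \<omega>)) \<longlonglongrightarrow> 0"
    proof eventually_elim
      case (elim \<omega>)
      have "(\<lambda>n. (\<bar>blinfun_apply g (f n \<omega>)\<bar> powr p) powr (1 / p)) \<longlonglongrightarrow> 0"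
        using p by (intro tendsto_zero_powrI[OF elim tendsto_const]) auto
      hence "(\<lambda>n. \<bar>blinfun_apply g (f n \<omega>)\<bar>) \<longlonglongrightarrow> 0" using p by (simp add: powr_powr)
      thus ?case by (rule tendsto_rabs_zero_cancel)
    qed
    thus ?thesis by (simp add: conv_ae_def)
  qed
  ultimately have ae: "scalarly conv_ae f"
    unfolding scalarly_def by (intro exI[of _ "\<lambda>_. 0"]) simp

  have "conv_in_Lp p (\<lambda>n \<omega>. blinfun_apply g (f n \<omega>)) (\<lambda>\<omega>. blinfun_apply g 0)" for g
  proof -
    have "in_Lp p (\<lambda>\<omega>. blinfun_apply g (f n \<omega>))" for n
      unfolding in_Lp_def real_norm_def using int[of g n] simple[of "\<lambda>l. blinfun_apply g (F n l)" n]
      by (simp add: f_def simple_function_imp_strongly_measurable)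
    moreover have "in_Lp p (\<lambda>\<omega>::real. 0 :: real)"
      unfolding in_Lp_def by (simp add: simple_function_imp_strongly_measurable)
    moreover have "(\<lambda>n. I g n powr (1 / p)) \<longlonglongrightarrow> 0"
      using p I0 by (intro tendsto_zero_powrI[OF summable_LIMSEQ_zero[OF summ_I] tendsto_const]) auto
    ultimately show ?thesis by (simp add: conv_in_Lp_def Lp_norm_def I_def)
  qed
  hence Lp: "scalarly (conv_in_Lp p) f"
    using \<open>strongly_measurable (\<lambda>_. 0 :: 'a)\<close>
    unfolding scalarly_def by (intro exI[of _ "\<lambda>_. 0"]) simp

  have "\<not> has_weakly_ae_convergent_subseq f"
  proof
    assume "has_weakly_ae_convergent_subseq f"
    then obtain r g where r: "strict_mono (r :: nat \<Rightarrow> nat)" and weak: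
      "AE \<omega> in Omega. \<forall>x' :: 'a \<Rightarrow>\<^sub>L real. (\<lambda>k. blinfun_apply x' (f (r k) \<omega>)) \<longlonglongrightarrow> blinfun_apply x' (g \<omega>)"
      unfolding has_weakly_ae_convergent_subseq_def converges_weakly_ae_def by blast
    \<comment> \<open>Weak convergence at a point would bound the norms there, by the uniform
      boundedness principle.\<close>
    have "AE \<omega> in Omega. \<exists>R. \<forall>k. norm (f (r k) \<omega>) \<le> R"
      using weak
    proof eventually_elim
      case (elim \<omega>)
      have "\<exists>K. \<forall>k. \<bar>blinfun_apply x' (f (r k) \<omega>)\<bar> \<le> K" for x' :: "'a \<Rightarrow>\<^sub>L real"
        using convergent_imp_Bseq[of "\<lambda>k. blinfun_apply x' (f (r k) \<omega>)"] elim
        by (auto simp: convergent_def Bseq_def)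
      thus ?case by (rule weakly_bounded_imp_bounded) blast
    qed
    moreover have "AE \<omega> in Omega. \<exists>k. real (Suc Q) \<le> (norm (f (r k) \<omega>) powr p)\<^sup>2" for Q
    proof -
      \<comment> \<open>\<open>H k\<close> collects the digits for which \<open>f k\<close> is not
        large, with the comparison cleared of denominators. Indices outside the subsequence impose
        no condition, so leaving some \<open>H k\<close> forces \<open>k\<close> into the range of
        \<open>r\<close>.\<close>
      define H where "H k = {l. l < N k \<and> (k \<in> range r \<longrightarrow> Suc k < Suc Q * Suc (l div T k))}" for k
      have H: "H k \<subseteq> {..<N k}" for k by (auto simp: H_def)
      \<comment> \<open>The \<open>q\<close> smallest quotients, with all their remainders, lie
        outside \<open>H k\<close>; they make up a proportion of the digits bounded below
        independently of \<open>k\<close>.\<close>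
      have card_H: "card (H k) \<le> (1 - 1 / (2 * real (Suc Q))) * N k" if "k \<in> range r" "Q \<le> k" for k
      proof -
        define q where "q = Suc k div Suc Q"
        have "H k \<subseteq> {q * T k..<N k}"
        proof
          fix l assume l: "l \<in> H k"
          have "\<not> l < q * T k"
          proof
            assume "l < q * T k"
            hence "Suc (l div T k) \<le> q" using T[of k] by (simp add: Suc_le_eq div_less_iff_less_mult)
            hence "Suc Q * Suc (l div T k) \<le> Suc Q * q" by (rule mult_le_mono2)
            also have "\<dots> \<le> Suc k" unfolding q_def by (rule times_div_less_eq_dividend)
            finally show False using l that(1) by (simp add: H_def)
          qed
          thus "l \<in> {q * T k..<N k}" using l by (simp add: H_def)
        qed
        hence "card (H k) \<le> N k - q * T k" using card_mono[of "{q * T k..<N k}" "H k"] by simp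
        moreover have "q * T k \<le> N k" unfolding N_def q_def by (intro mult_le_mono1 div_le_dividend)
        ultimately have "real (card (H k)) \<le> real (N k) - real q * T k"
          by (simp add: of_nat_diff flip: of_nat_mult)
        also have "\<dots> = (real (Suc k) - q) * T k" by (simp add: N_def algebra_simps)
        also have "\<dots> \<le> ((1 - 1 / (2 * real (Suc Q))) * Suc k) * T k"
        proof (rule mult_right_mono)
          \<comment> \<open>Since \<open>Q \<le> k\<close>, rounding down in \<open>q\<close> loses
            at most half: \<open>Suc k < Suc Q * q + Suc Q \<le> 2 * (Suc Q * q)\<close>.\<close>
          have "1 \<le> q" unfolding q_def using that(2) by (simp add: Suc_le_eq div_greater_zero_iff)
          hence "Suc Q * 1 \<le> Suc Q * q" by (rule mult_le_mono2)
          moreover have "Suc k < Suc Q * q + Suc Q"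
            using mult_div_mod_eq[of "Suc Q" "Suc k"] mod_less_divisor[OF zero_less_Suc, of "Suc k" Q]
            unfolding q_def by linarith
          moreover define w where "w = Suc Q * q"
          ultimately have "Suc k \<le> 2 * w" by simp
          hence "Suc k \<le> 2 * (Suc Q * q)" unfolding w_def .
          hence "real (Suc k) \<le> real (2 * (Suc Q * q))" by (simp only: of_nat_le_iff)
          hence "real (Suc k) \<le> 2 * (real (Suc Q) * real q)" by (simp only: of_nat_mult of_nat_numeral)
          hence "real (Suc k) / (2 * real (Suc Q)) \<le> q" by (simp add: field_simps del: of_nat_Suc)
          thus "real (Suc k) - q \<le> (1 - 1 / (2 * real (Suc Q))) * Suc k"
            by (simp add: algebra_simps del: of_nat_Suc)
        qed simp
        finally show ?thesis by (simp only: N_def of_nat_mult mult.assoc)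
      qed
      have "infinite (range r)" using r by (simp add: strict_mono_imp_inj_on range_inj_infinite)
      hence "infinite (range r - {..<Q})" by simp
      hence "infinite {k. card (H k) \<le> (1 - 1 / (2 * real (Suc Q))) * N k}"
        by (rule infinite_super[rotated]) (use card_H in auto)
      hence "AE \<omega> in Omega. \<exists>k. mixed_radix_digit N k \<omega> \<notin> H k"
        by (intro mixed_radix_digits_AE_leave[OF N H]) auto
      thus ?thesis
      proof eventually_elim
        case (elim \<omega>)
        then obtain k where k: "mixed_radix_digit N k \<omega> \<notin> H k" by blast
        let ?a = "mixed_radix_digit N k \<omega> div T k"
        have "mixed_radix_digit N k \<omega> < N k" using N by (simp add: mixed_radix_digit_def)
        hence kr: "k \<in> range r" "Suc Q * Suc ?a \<le> Suc k" using k by (auto simp: H_def not_less)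
        from kr(2) have "real (Suc Q * Suc ?a) \<le> real (Suc k)" by (simp only: of_nat_le_iff)
        hence "real (Suc Q) * real (Suc ?a) \<le> real (Suc k)" by (simp only: of_nat_mult)
        hence "real (Suc Q) \<le> real (Suc k) / (real ?a + 1)" by (simp add: field_simps)
        also have "\<dots> = (s k ?a)\<^sup>2" by (simp add: s_def)
        also have "\<dots> = (norm (f k \<omega>) powr p)\<^sup>2" by (simp add: f_def norm_F)
        finally show ?case using kr(1) by blast
      qed
    qed
    \<comment> \<open>The exceptional sets for the countably many levels \<open>Q\<close> are
      merged, so a.e. no single bound \<open>R\<close> can hold.\<close>
    hence "AE \<omega> in Omega. \<forall>Q. \<exists>k. real (Suc Q) \<le> (norm (f (r k) \<omega>) powr p)\<^sup>2"
      by (simp add: AE_all_countable)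
    ultimately have "AE \<omega> in Omega. False"
    proof eventually_elim
      case (elim \<omega>)
      then obtain R where R: "\<And>k. norm (f (r k) \<omega>) \<le> R" by blast
      obtain Q :: nat where Q: "(R powr p)\<^sup>2 \<le> Q" using real_arch_simple by blast
      obtain k where "real (Suc Q) \<le> (norm (f (r k) \<omega>) powr p)\<^sup>2" using elim by blast
      also have "\<dots> \<le> (R powr p)\<^sup>2" using R[of k] p by (intro power_mono powr_mono2) auto
      finally show False using Q by simp
    qed
    thus False using AE_Omega_not_False by blast
  qed
  with bounded ae Lp show ?thesis by blast
qed

theorem corollary4p4:
  fixes p :: real
  assumes "1 \<le> p"
  shows "(finite_dimensional TYPE('a::banach) \<longleftrightarrow> property_A' TYPE('a) p) \<and>
         (property_A' TYPE('a) p \<longleftrightarrow> property_A TYPE('a) p) \<and>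
         (property_A TYPE('a) p \<longleftrightarrow> property_B TYPE('a) p) \<and>
         (property_B TYPE('a) p \<longleftrightarrow> property_C TYPE('a) p)"
proof -
  \<comment> \<open>The counterexample closes two cycles through finite dimension, one by
    \<open>property_A'\<close> and \<open>property_A\<close>, the other by \<open>property_B\<close>
    and \<open>property_C\<close>.\<close>
  have "finite_dimensional TYPE('a)" if "property_A TYPE('a) p \<or> property_C TYPE('a) p"
  proof (rule ccontr)
    assume "\<not> finite_dimensional TYPE('a)"
    then obtain f :: "nat \<Rightarrow> real \<Rightarrow> 'a" where "Lp_bounded p f" "scalarly conv_ae f"
      "scalarly (conv_in_Lp p) f" "\<not> has_weakly_ae_convergent_subseq f"
      using scalarly_null_sequence_without_weak_limit[OF _ assms] by blast
    thus False using that unfolding property_A_def property_C_def by blast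
  qed
  thus ?thesis
    using finite_dimensional_imp_property_A'[where 'a = 'a and p = p] property_A'_imp_A[where 'a = 'a and p = p]
      finite_dimensional_imp_property_B[where 'a = 'a and p = p] property_B_imp_C[OF assms, where 'a = 'a]
    by blast
qed

end
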